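(* Let $\mathcal R$ be a groupoid, $(+,0,b,l^+,r^+)$ an AC 2-group structure on $\mathcal R$, and $(\cdot,1,a^\times,l^\times,r^\times)$ a monoidal structure on $\mathcal R$ (write $xy$ for $x\cdot y$). Let $d_{x,y,z}:xy+xz\to x(y+z)$ and $e_{x,y,z}:xz+yz\to(x+y)z$ be families of isomorphisms natural in $x,y,z$, and let $m_x:0\to x0$ and $n_x:0\to 0x$ be families of isomorphisms. Then $(\mathcal R,(+,0,b,l^+,r^+),(\cdot,1,a^\times,l^\times,r^\times),(d,m),(e,n))$ is an AC 2-ring if and only if $m_x$ and $n_x$ are natural in $x$ and the following equalities hold for all objects $x,y,z,t,u$ of $\mathcal R$: (2R1)$''$ - $d_{x,y+t,z+u}\circ(d_{x,y,t}+d_{x,z,u})\circ b(xy,xz,xt,xu)=(\mathrm{id}_x\cdot b(y,z,t,u))\circ d_{x,y+z,t+u}\circ(d_{x,y,z}+d_{x,t,u})$; - $e_{x+z,y+t,u}\circ(e_{x,z,u}+e_{y,t,u})\circ b(xu,yu,zu,tu)=(b(x,y,z,t)\cdot\mathrm{id}_u)\circ e_{x+y,z+t,u}\circ(e_{x,y,u}+e_{z,t,u})$; - $(\mathrm{id}_x\cdot l^+_y)\circ d_{x,0,y}\circ(m_x+\mathrm{id}_{xy})=l^+_{xy}$ and $(\mathrm{id}_x\cdot r^+_y)\circ d_{x,y,0}\circ(\mathrm{id}_{xy}+m_x)=r^+_{xy}$; - $(l^+_x\cdot\mathrm{id}_y)\circ e_{0,x,y}\circ(n_y+\mathrm{id}_{xy})=l^+_{xy}$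 and $(r^+_x\cdot\mathrm{id}_y)\circ e_{x,0,y}\circ(\mathrm{id}_{xy}+n_y)=r^+_{xy}$; (2R2) $d_{x+y,z,t}\circ(e_{x,y,z}+e_{x,y,t})\circ b(xz,xt,yz,yt)=e_{x,y,z+t}\circ(d_{x,z,t}+d_{y,z,t})$; (2R3) $d_{xy,z,t}\circ(a^\times_{x,y,z}+a^\times_{x,y,t})=a^\times_{x,y,z+t}\circ(\mathrm{id}_x\cdot d_{y,z,t})\circ d_{x,yz,yt}$; (2R4) $(d_{x,z,t}\cdot\mathrm{id}_y)\circ e_{xz,xt,y}\circ(a^\times_{x,z,y}+a^\times_{x,t,y})=a^\times_{x,z+t,y}\circ(\mathrm{id}_x\cdot e_{z,t,y})\circ d_{x,zy,ty}$; (2R5) $(e_{t,z,y}\cdot\mathrm{id}_x)\circ e_{ty,zy,x}\circ(a^\times_{t,y,x}+a^\times_{z,y,x})=a^\times_{t+z,y,x}\circ e_{t,z,yx}$; (2R6) $l^\times_{x+y}\circ d_{1,x,y}=l^\times_x+l^\times_y$ and $r^\times_{x+y}\circ e_{x,y,1}=r^\times_x+r^\times_y$.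
   Context: A monoidal structure $(\cdot,1,a^\times,l^\times,r^\times)$ has associators $a^\times_{x,y,z}:x(yz)\to(xy)z$ and unitors $l^\times_x:1x\to x$, $r^\times_x:x1\to x$ satisfying the usual pentagon and triangle axioms. AC 2-group $(\mathcal R,+,0,b,l,r)$: a groupoid $\mathcal R$, a functor $+:\mathcal R\times\mathcal R\to\mathcal R$, an object $0$, natural isomorphisms $b(x,y,z,t):(x+y)+(z+t)\to(x+z)+(y+t)$, $l_x:0+x\to x$, $r_x:x+0\to x$, such that every object $x$ has a weak inverse $\overline x$ for $+$ ($x+\overline x\cong0\cong\overline x+x$) and, for all objects: (AC1) $(b(x,z,x',z')+b(y,t,y',t'))\circ b(x+z,y+t,x'+z',y'+t')\circ(b(x,y,z,t)+b(x',y',z',t'))=b(x+x',y+y',z+z',t+t')\circ(b(x,y,x',y')+b(z,t,z',t'))\circ b(x+y,z+t,x'+y',z'+t')$; (AC2) $r_{x+y}\circ(\mathrm{id}+l_0)\circ b(x,0,y,0)=r_x+r_y$; $\ l_{x+y}\circ(r_0+\mathrm{id})\circ b(0,x,0,y)=l_x+l_y$; $\ (r_x+r_y)\circ b(x,y,0,0)=r_{x+y}\circ(\mathrm{id}+l_0)$; $\ (l_x+l_y)\circ b(0,0,x,y)=l_{x+y}\circ(r_0+\mathrm{id})$; (AC3) $b(x,0,0,y)=\mathrm{id}$. An AC endofunctor (endomorphism) of the AC 2-group is a triple $\mathbb F=(F,F_+,F_0)$ with $F:\mathcal R\to\mathcal R$ a functor, $F_+(x,y):Fx+Fy\to F(x+y)$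 natural isomorphisms, $F_0:0\to F0$ an isomorphism, such that $F_+(x+z,y+t)\circ(F_+(x,z)+F_+(y,t))\circ b(Fx,Fy,Fz,Ft)=F(b(x,y,z,t))\circ F_+(x+y,z+t)\circ(F_+(x,y)+F_+(z,t))$, $F(l_x)\circ F_+(0,x)\circ(F_0+\mathrm{id})=l_{Fx}$ and $F(r_x)\circ F_+(x,0)\circ(\mathrm{id}+F_0)=r_{Fx}$. An AC natural isomorphism $\tau:\mathbb F\Rightarrow\mathbb F'$ is a natural isomorphism $\tau:F\Rightarrow F'$ with $\tau_{x+y}\circ F_+(x,y)=F'_+(x,y)\circ(\tau_x+\tau_y)$ and $\tau_0\circ F_0=F'_0$. Composition: $(F'\circ F)_+(x,y)=F'(F_+(x,y))\circ F'_+(Fx,Fy)$ and $(F'\circ F)_0=F'(F_0)\circ F'_0$. Sum: $(F\boxplus F')(-)=F(-)+F'(-)$ on objects and morphisms, $(F\boxplus F')_+(x,y)=(F_+(x,y)+F'_+(x,y))\circ b(Fx,F'x,Fy,F'y)$, $(F\boxplus F')_0=(F_0+F'_0)\circ l_0^{-1}$ (where $l_0=r_0:0+0\to0$). The identity endofunctor carries identity structure isomorphisms. AC 2-ring: a tuple $(\mathcal R,(+,0,b,l^+,r^+),(\cdot,1,a^\times,l^\times,r^\times),(d,m),(e,n))$ with $\mathcal R$ a groupoid, $\mathcal R_+=(\mathcal R,+,0,b,l^+,r^+)$ an AC 2-group, $(\cdot,1,a^\times,l^\times,r^\times)$ a monoidal structure on $\mathcal R$, isomorphisms $d_{x,y,z}:xy+xz\to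 x(y+z)$ and $e_{x,y,z}:xz+yz\to(x+y)z$ natural in all variables, and isomorphisms $m_x:0\to x0$, $n_z:0\to0z$, such that $\mathbb x\cdot-:=(x\cdot-,d_{x,-,-},m_x)$ and $-\cdot\mathbb z:=(-\cdot z,e_{-,-,z},n_z)$ are AC endofunctors of $\mathcal R_+$ for all objects $x,z$, and for all objects $x,y,z$ the following are AC natural isomorphisms: (2R2)$'$ $e_{x,y,-}:(\mathbb x\cdot-)\boxplus(\mathbb y\cdot-)\Rightarrow(\mathbb x+\mathbb y)\cdot-$ (equivalently $d_{-,y,z}:(-\cdot\mathbb y)\boxplus(-\cdot\mathbb z)\Rightarrow-\cdot(\mathbb y+\mathbb z)$); (2R3)$'$ $a^\times_{x,y,-}:(\mathbb x\cdot-)\circ(\mathbb y\cdot-)\Rightarrow(\mathbb x\mathbb y)\cdot-$; (2R4)$'$ $a^\times_{x,-,z}:(\mathbb x\cdot-)\circ(-\cdot\mathbb z)\Rightarrow(-\cdot\mathbb z)\circ(\mathbb x\cdot-)$; (2R5)$'$ $a^\times_{-,y,z}:-\cdot(\mathbb y\mathbb z)\Rightarrow(-\cdot\mathbb z)\circ(-\cdot\mathbb y)$; (2R6)$'$ $l^\times_-:\mathbb 1\cdot-\Rightarrow\mathrm{id}_{\mathcal R_+}$ and $r^\times_-:-\cdot\mathbb 1\Rightarrow\mathrm{id}_{\mathcal R_+}$. Here $(\mathbb x+\mathbb y)\cdot-$, $(\mathbb x\mathbb y)\cdot-$, etc. denote the endofunctors attached to the objects $x+y$, $xy$, etc. *)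

theory Defs
  imports Main
begin

text \<open>
  One chain of records carries all the data, so that a single structure \<open>R\<close> can be used
  with indexed notation. The symbols \<open>\<oplus>\<close>, \<open>\<otimes>\<close> are the two operations on objects,
  and the bold signs are the same operations on arrows. As usual, the values of the
  operations outside the carriers \<open>obj\<close>, \<open>arr\<close> are irrelevant, and \<open>g \<bullet> f\<close>
  (first \<open>f\<close>, then \<open>g\<close>) is meaningful only if \<open>src g = trg f\<close>.
\<close>

record ('o, 'm) cat_data =
  obj :: "'o set"
  arr :: "'m set"
  src :: "'m \<Rightarrow> 'o"
  trg :: "'m \<Rightarrow> 'o"
  ident :: "'o \<Rightarrow> 'm"  (\<open>\<i>\<d>\<index>\<close>)
  cmp :: "'m \<Rightarrow> 'm \<Rightarrow> 'm"  (infixr \<open>\<bullet>\<index>\<close> 55)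

record ('o, 'm) add_data = "('o, 'm) cat_data" +
  add_obj :: "'o \<Rightarrow> 'o \<Rightarrow> 'o"  (infixl \<open>\<oplus>\<index>\<close> 65)
  add_arr :: "'m \<Rightarrow> 'm \<Rightarrow> 'm"  (infixl \<open>\<^bold>+\<index>\<close> 65)
  zero_obj :: "'o"  (\<open>\<zero>\<index>\<close>)
  add_b :: "'o \<Rightarrow> 'o \<Rightarrow> 'o \<Rightarrow> 'o \<Rightarrow> 'm"  (\<open>\<b>\<index>\<close>)
  add_l :: "'o \<Rightarrow> 'm"  (\<open>\<l>\<^sup>+\<index>\<close>)
  add_r :: "'o \<Rightarrow> 'm"  (\<open>\<r>\<^sup>+\<index>\<close>)

record ('o, 'm) mult_data = "('o, 'm) add_data" +
  mult_obj :: "'o \<Rightarrow> 'o \<Rightarrow> 'o"  (infixl \<open>\<otimes>\<index>\<close> 70)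
  mult_arr :: "'m \<Rightarrow> 'm \<Rightarrow> 'm"  (infixl \<open>\<^bold>*\<index>\<close> 70)
  one_obj :: "'o"  (\<open>\<one>\<index>\<close>)
  mult_a :: "'o \<Rightarrow> 'o \<Rightarrow> 'o \<Rightarrow> 'm"  (\<open>\<a>\<^sup>\<times>\<index>\<close>)
  mult_l :: "'o \<Rightarrow> 'm"  (\<open>\<l>\<^sup>\<times>\<index>\<close>)
  mult_r :: "'o \<Rightarrow> 'm"  (\<open>\<r>\<^sup>\<times>\<index>\<close>)

record ('o, 'm) ring_data = "('o, 'm) mult_data" +
  dist_d :: "'o \<Rightarrow> 'o \<Rightarrow> 'o \<Rightarrow> 'm"  (\<open>\<d>\<index>\<close>)
  dist_m :: "'o \<Rightarrow> 'm"  (\<open>\<m>\<index>\<close>)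
  dist_e :: "'o \<Rightarrow> 'o \<Rightarrow> 'o \<Rightarrow> 'm"  (\<open>\<e>\<index>\<close>)
  dist_n :: "'o \<Rightarrow> 'm"  (\<open>\<n>\<index>\<close>)


section \<open>Categories and groupoids\<close>

definition hom :: "('o, 'm, 'r) cat_data_scheme \<Rightarrow> 'o \<Rightarrow> 'o \<Rightarrow> 'm set"
  where "hom R x y = {f \<in> arr R. src R f = x \<and> trg R f = y}"

definition iso :: "('o, 'm, 'r) cat_data_scheme \<Rightarrow> 'o \<Rightarrow> 'o \<Rightarrow> 'm set"
  where "iso R x y = {f \<in> hom R x y. \<exists>g \<in> hom R y x.
    g \<bullet>\<^bsub>R\<^esub> f = \<i>\<d>\<^bsub>R\<^esub> x \<and> f \<bullet>\<^bsub>R\<^esub> g = \<i>\<d>\<^bsub>R\<^esub> y}"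

definition inverse_arr :: "('o, 'm, 'r) cat_data_scheme \<Rightarrow> 'm \<Rightarrow> 'm"
  where "inverse_arr R f = (THE g. g \<in> hom R (trg R f) (src R f) \<and>
    g \<bullet>\<^bsub>R\<^esub> f = \<i>\<d>\<^bsub>R\<^esub> (src R f) \<and> f \<bullet>\<^bsub>R\<^esub> g = \<i>\<d>\<^bsub>R\<^esub> (trg R f))"

locale category =
  fixes R :: "('o, 'm, 'r) cat_data_scheme" (structure)
  assumes src_obj: "f \<in> arr R \<Longrightarrow> src R f \<in> obj R"
    and trg_obj: "f \<in> arr R \<Longrightarrow> trg R f \<in> obj R"
    and id_hom: "x \<in> obj R \<Longrightarrow> \<i>\<d> x \<in> hom R x x"
    and comp_hom: "f \<in> hom R x y \<Longrightarrow> g \<in> hom R y z \<Longrightarrow> g \<bullet> f \<in> hom R x z"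
    and comp_id_left: "f \<in> hom R x y \<Longrightarrow> \<i>\<d> y \<bullet> f = f"
    and comp_id_right: "f \<in> hom R x y \<Longrightarrow> f \<bullet> \<i>\<d> x = f"
    and comp_assoc: "f \<in> hom R x y \<Longrightarrow> g \<in> hom R y z \<Longrightarrow> h \<in> hom R z t \<Longrightarrow>
      h \<bullet> (g \<bullet> f) = (h \<bullet> g) \<bullet> f"

locale groupoid = category +
  assumes all_iso: "f \<in> hom R x y \<Longrightarrow> f \<in> iso R x y"

text \<open>Functors \<open>R \<times> R \<rightarrow> R\<close>, spelled out without forming the product category.\<close>

definition bifunctor ::
    "('o, 'm, 'r) cat_data_scheme \<Rightarrow> ('o \<Rightarrow> 'o \<Rightarrow> 'o) \<Rightarrow> ('m \<Rightarrow> 'm \<Rightarrow> 'm) \<Rightarrow> bool"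
  where "bifunctor R P p \<longleftrightarrow>
    (\<forall>x \<in> obj R. \<forall>y \<in> obj R. P x y \<in> obj R) \<and>
    (\<forall>x x' y y' f g. f \<in> hom R x x' \<longrightarrow> g \<in> hom R y y' \<longrightarrow> p f g \<in> hom R (P x y) (P x' y')) \<and>
    (\<forall>x \<in> obj R. \<forall>y \<in> obj R. p (\<i>\<d>\<^bsub>R\<^esub> x) (\<i>\<d>\<^bsub>R\<^esub> y) = \<i>\<d>\<^bsub>R\<^esub> (P x y)) \<and>
    (\<forall>x x' x'' y y' y'' f f' g g'.
      f \<in> hom R x x' \<longrightarrow> f' \<in> hom R x' x'' \<longrightarrow> g \<in> hom R y y' \<longrightarrow> g' \<in> hom R y' y'' \<longrightarrow>
      p (f' \<bullet>\<^bsub>R\<^esub> f) (g' \<bullet>\<^bsub>R\<^esub> g) = p f' g' \<bullet>\<^bsub>R\<^esub> p f g)"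


section \<open>AC 2-groups\<close>

locale ac_2group = groupoid R
  for R :: "('o, 'm, 'r) add_data_scheme" (structure) +
  assumes add_bifunctor: "bifunctor R (\<oplus>) (\<^bold>+)"
    and zero_in_obj: "\<zero> \<in> obj R"
    and b_iso: "\<lbrakk>x \<in> obj R; y \<in> obj R; z \<in> obj R; t \<in> obj R\<rbrakk> \<Longrightarrow>
      \<b> x y z t \<in> iso R ((x \<oplus> y) \<oplus> (z \<oplus> t)) ((x \<oplus> z) \<oplus> (y \<oplus> t))"
    and b_natural: "\<lbrakk>f \<in> hom R x x'; g \<in> hom R y y'; h \<in> hom R z z'; k \<in> hom R t t'\<rbrakk> \<Longrightarrow>
      \<b> x' y' z' t' \<bullet> ((f \<^bold>+ g) \<^bold>+ (h \<^bold>+ k)) = ((f \<^bold>+ h) \<^bold>+ (g \<^bold>+ k)) \<bullet> \<b> x y z t"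
    and add_l_iso: "x \<in> obj R \<Longrightarrow> \<l>\<^sup>+ x \<in> iso R (\<zero> \<oplus> x) x"
    and add_l_natural: "f \<in> hom R x x' \<Longrightarrow> \<l>\<^sup>+ x' \<bullet> (\<i>\<d> \<zero> \<^bold>+ f) = f \<bullet> \<l>\<^sup>+ x"
    and add_r_iso: "x \<in> obj R \<Longrightarrow> \<r>\<^sup>+ x \<in> iso R (x \<oplus> \<zero>) x"
    and add_r_natural: "f \<in> hom R x x' \<Longrightarrow> \<r>\<^sup>+ x' \<bullet> (f \<^bold>+ \<i>\<d> \<zero>) = f \<bullet> \<r>\<^sup>+ x"
    and weak_inverse: "x \<in> obj R \<Longrightarrow>
      \<exists>x' \<in> obj R. iso R (x \<oplus> x') \<zero> \<noteq> {} \<and> iso R (x' \<oplus> x) \<zero> \<noteq> {}"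
    and AC1: "\<lbrakk>x \<in> obj R; y \<in> obj R; z \<in> obj R; t \<in> obj R;
               x' \<in> obj R; y' \<in> obj R; z' \<in> obj R; t' \<in> obj R\<rbrakk> \<Longrightarrow>
      (\<b> x z x' z' \<^bold>+ \<b> y t y' t') \<bullet> \<b> (x \<oplus> z) (y \<oplus> t) (x' \<oplus> z') (y' \<oplus> t') \<bullet>
        (\<b> x y z t \<^bold>+ \<b> x' y' z' t')
      = \<b> (x \<oplus> x') (y \<oplus> y') (z \<oplus> z') (t \<oplus> t') \<bullet> (\<b> x y x' y' \<^bold>+ \<b> z t z' t') \<bullet>
        \<b> (x \<oplus> y) (z \<oplus> t) (x' \<oplus> y') (z' \<oplus> t')"
    and AC2_r: "\<lbrakk>x \<in> obj R; y \<in> obj R\<rbrakk> \<Longrightarrow>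
      \<r>\<^sup>+ (x \<oplus> y) \<bullet> (\<i>\<d> (x \<oplus> y) \<^bold>+ \<l>\<^sup>+ \<zero>) \<bullet> \<b> x \<zero> y \<zero> = \<r>\<^sup>+ x \<^bold>+ \<r>\<^sup>+ y"
    and AC2_l: "\<lbrakk>x \<in> obj R; y \<in> obj R\<rbrakk> \<Longrightarrow>
      \<l>\<^sup>+ (x \<oplus> y) \<bullet> (\<r>\<^sup>+ \<zero> \<^bold>+ \<i>\<d> (x \<oplus> y)) \<bullet> \<b> \<zero> x \<zero> y = \<l>\<^sup>+ x \<^bold>+ \<l>\<^sup>+ y"
    and AC2_r': "\<lbrakk>x \<in> obj R; y \<in> obj R\<rbrakk> \<Longrightarrow>
      (\<r>\<^sup>+ x \<^bold>+ \<r>\<^sup>+ y) \<bullet> \<b> x y \<zero> \<zero> = \<r>\<^sup>+ (x \<oplus> y) \<bullet> (\<i>\<d> (x \<oplus> y) \<^bold>+ \<l>\<^sup>+ \<zero>)"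
    and AC2_l': "\<lbrakk>x \<in> obj R; y \<in> obj R\<rbrakk> \<Longrightarrow>
      (\<l>\<^sup>+ x \<^bold>+ \<l>\<^sup>+ y) \<bullet> \<b> \<zero> \<zero> x y = \<l>\<^sup>+ (x \<oplus> y) \<bullet> (\<r>\<^sup>+ \<zero> \<^bold>+ \<i>\<d> (x \<oplus> y))"
    and AC3: "\<lbrakk>x \<in> obj R; y \<in> obj R\<rbrakk> \<Longrightarrow> \<b> x \<zero> \<zero> y = \<i>\<d> ((x \<oplus> \<zero>) \<oplus> (\<zero> \<oplus> y))"


section \<open>Monoidal structures\<close>

locale monoidal = category R
  for R :: "('o, 'm, 'r) mult_data_scheme" (structure) +
  assumes mult_bifunctor: "bifunctor R (\<otimes>) (\<^bold>*)"
    and one_in_obj: "\<one> \<in> obj R"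
    and mult_a_iso: "\<lbrakk>x \<in> obj R; y \<in> obj R; z \<in> obj R\<rbrakk> \<Longrightarrow>
      \<a>\<^sup>\<times> x y z \<in> iso R (x \<otimes> (y \<otimes> z)) ((x \<otimes> y) \<otimes> z)"
    and mult_a_natural: "\<lbrakk>f \<in> hom R x x'; g \<in> hom R y y'; h \<in> hom R z z'\<rbrakk> \<Longrightarrow>
      \<a>\<^sup>\<times> x' y' z' \<bullet> (f \<^bold>* (g \<^bold>* h)) = ((f \<^bold>* g) \<^bold>* h) \<bullet> \<a>\<^sup>\<times> x y z"
    and mult_l_iso: "x \<in> obj R \<Longrightarrow> \<l>\<^sup>\<times> x \<in> iso R (\<one> \<otimes> x) x"
    and mult_l_natural: "f \<in> hom R x x' \<Longrightarrow> \<l>\<^sup>\<times> x' \<bullet> (\<i>\<d> \<one> \<^bold>* f) = f \<bullet> \<l>\<^sup>\<times> x"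
    and mult_r_iso: "x \<in> obj R \<Longrightarrow> \<r>\<^sup>\<times> x \<in> iso R (x \<otimes> \<one>) x"
    and mult_r_natural: "f \<in> hom R x x' \<Longrightarrow> \<r>\<^sup>\<times> x' \<bullet> (f \<^bold>* \<i>\<d> \<one>) = f \<bullet> \<r>\<^sup>\<times> x"
    and pentagon: "\<lbrakk>x \<in> obj R; y \<in> obj R; z \<in> obj R; t \<in> obj R\<rbrakk> \<Longrightarrow>
      \<a>\<^sup>\<times> (x \<otimes> y) z t \<bullet> \<a>\<^sup>\<times> x y (z \<otimes> t)
      = (\<a>\<^sup>\<times> x y z \<^bold>* \<i>\<d> t) \<bullet> \<a>\<^sup>\<times> x (y \<otimes> z) t \<bullet> (\<i>\<d> x \<^bold>* \<a>\<^sup>\<times> y z t)"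
    and triangle: "\<lbrakk>x \<in> obj R; y \<in> obj R\<rbrakk> \<Longrightarrow>
      (\<r>\<^sup>\<times> x \<^bold>* \<i>\<d> y) \<bullet> \<a>\<^sup>\<times> x \<one> y = \<i>\<d> x \<^bold>* \<l>\<^sup>\<times> y"


section \<open>AC endofunctors and AC natural isomorphisms\<close>

record ('o, 'm) endo =
  on_obj :: "'o \<Rightarrow> 'o"
  on_arr :: "'m \<Rightarrow> 'm"
  on_plus :: "'o \<Rightarrow> 'o \<Rightarrow> 'm"
  on_zero :: "'m"

locale ac_endofunctor = ac_2group R
  for R :: "('o, 'm, 'r) add_data_scheme" (structure)
    and F :: "('o, 'm) endo" +
  assumes on_obj: "x \<in> obj R \<Longrightarrow> on_obj F x \<in> obj R"
    and on_arr: "f \<in> hom R x y \<Longrightarrow> on_arr F f \<in> hom R (on_obj F x) (on_obj F y)"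
    and on_id: "x \<in> obj R \<Longrightarrow> on_arr F (\<i>\<d> x) = \<i>\<d> (on_obj F x)"
    and on_comp: "f \<in> hom R x y \<Longrightarrow> g \<in> hom R y z \<Longrightarrow>
      on_arr F (g \<bullet> f) = on_arr F g \<bullet> on_arr F f"
    and plus_iso: "\<lbrakk>x \<in> obj R; y \<in> obj R\<rbrakk> \<Longrightarrow>
      on_plus F x y \<in> iso R (on_obj F x \<oplus> on_obj F y) (on_obj F (x \<oplus> y))"
    and plus_natural: "\<lbrakk>f \<in> hom R x x'; g \<in> hom R y y'\<rbrakk> \<Longrightarrow>
      on_plus F x' y' \<bullet> (on_arr F f \<^bold>+ on_arr F g) = on_arr F (f \<^bold>+ g) \<bullet> on_plus F x y"
    and zero_iso: "on_zero F \<in> iso R \<zero> (on_obj F \<zero>)"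
    and plus_b: "\<lbrakk>x \<in> obj R; y \<in> obj R; z \<in> obj R; t \<in> obj R\<rbrakk> \<Longrightarrow>
      on_plus F (x \<oplus> z) (y \<oplus> t) \<bullet> (on_plus F x z \<^bold>+ on_plus F y t) \<bullet>
        \<b> (on_obj F x) (on_obj F y) (on_obj F z) (on_obj F t)
      = on_arr F (\<b> x y z t) \<bullet> on_plus F (x \<oplus> y) (z \<oplus> t) \<bullet> (on_plus F x y \<^bold>+ on_plus F z t)"
    and plus_l: "x \<in> obj R \<Longrightarrow>
      on_arr F (\<l>\<^sup>+ x) \<bullet> on_plus F \<zero> x \<bullet> (on_zero F \<^bold>+ \<i>\<d> (on_obj F x)) = \<l>\<^sup>+ (on_obj F x)"
    and plus_r: "x \<in> obj R \<Longrightarrow>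
      on_arr F (\<r>\<^sup>+ x) \<bullet> on_plus F x \<zero> \<bullet> (\<i>\<d> (on_obj F x) \<^bold>+ on_zero F) = \<r>\<^sup>+ (on_obj F x)"

locale ac_natural_iso = F: ac_endofunctor R F + F': ac_endofunctor R F'
  for R :: "('o, 'm, 'r) add_data_scheme" (structure)
    and F F' :: "('o, 'm) endo" +
  fixes \<tau> :: "'o \<Rightarrow> 'm"
  assumes component_iso: "x \<in> obj R \<Longrightarrow> \<tau> x \<in> iso R (on_obj F x) (on_obj F' x)"
    and natural: "f \<in> hom R x y \<Longrightarrow> \<tau> y \<bullet> on_arr F f = on_arr F' f \<bullet> \<tau> x"
    and plus_compat: "\<lbrakk>x \<in> obj R; y \<in> obj R\<rbrakk> \<Longrightarrow>
      \<tau> (x \<oplus> y) \<bullet> on_plus F x y = on_plus F' x y \<bullet> (\<tau> x \<^bold>+ \<tau> y)"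
    and zero_compat: "\<tau> \<zero> \<bullet> on_zero F = on_zero F'"

definition endo_id :: "('o, 'm, 'r) add_data_scheme \<Rightarrow> ('o, 'm) endo"
  where "endo_id R = \<lparr>
    on_obj = (\<lambda>x. x),
    on_arr = (\<lambda>f. f),
    on_plus = (\<lambda>x y. \<i>\<d>\<^bsub>R\<^esub> (x \<oplus>\<^bsub>R\<^esub> y)),
    on_zero = \<i>\<d>\<^bsub>R\<^esub> \<zero>\<^bsub>R\<^esub>\<rparr>"

definition endo_comp ::
    "('o, 'm, 'r) add_data_scheme \<Rightarrow> ('o, 'm) endo \<Rightarrow> ('o, 'm) endo \<Rightarrow> ('o, 'm) endo"
  (infixr \<open>\<odot>\<index>\<close> 75)
  where "F' \<odot>\<^bsub>R\<^esub> F = \<lparr>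
    on_obj = (\<lambda>x. on_obj F' (on_obj F x)),
    on_arr = (\<lambda>f. on_arr F' (on_arr F f)),
    on_plus = (\<lambda>x y. on_arr F' (on_plus F x y) \<bullet>\<^bsub>R\<^esub> on_plus F' (on_obj F x) (on_obj F y)),
    on_zero = on_arr F' (on_zero F) \<bullet>\<^bsub>R\<^esub> on_zero F'\<rparr>"

definition endo_sum ::
    "('o, 'm, 'r) add_data_scheme \<Rightarrow> ('o, 'm) endo \<Rightarrow> ('o, 'm) endo \<Rightarrow> ('o, 'm) endo"
  (infixl \<open>\<boxplus>\<index>\<close> 65)
  where "F \<boxplus>\<^bsub>R\<^esub> F' = \<lparr>
    on_obj = (\<lambda>x. on_obj F x \<oplus>\<^bsub>R\<^esub> on_obj F' x),
    on_arr = (\<lambda>f. on_arr F f \<^bold>+\<^bsub>R\<^esub> on_arr F' f),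
    on_plus = (\<lambda>x y. (on_plus F x y \<^bold>+\<^bsub>R\<^esub> on_plus F' x y) \<bullet>\<^bsub>R\<^esub>
      \<b>\<^bsub>R\<^esub> (on_obj F x) (on_obj F' x) (on_obj F y) (on_obj F' y)),
    on_zero = (on_zero F \<^bold>+\<^bsub>R\<^esub> on_zero F') \<bullet>\<^bsub>R\<^esub> inverse_arr R (\<l>\<^sup>+\<^bsub>R\<^esub> \<zero>\<^bsub>R\<^esub>)\<rparr>"


section \<open>AC 2-rings\<close>

definition left_mult :: "('o, 'm, 'r) ring_data_scheme \<Rightarrow> 'o \<Rightarrow> ('o, 'm) endo"
  where "left_mult R x = \<lparr>
    on_obj = (\<lambda>y. x \<otimes>\<^bsub>R\<^esub> y),
    on_arr = (\<lambda>f. \<i>\<d>\<^bsub>R\<^esub> x \<^bold>*\<^bsub>R\<^esub> f),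
    on_plus = (\<lambda>y z. \<d>\<^bsub>R\<^esub> x y z),
    on_zero = \<m>\<^bsub>R\<^esub> x\<rparr>"

definition right_mult :: "('o, 'm, 'r) ring_data_scheme \<Rightarrow> 'o \<Rightarrow> ('o, 'm) endo"
  where "right_mult R z = \<lparr>
    on_obj = (\<lambda>x. x \<otimes>\<^bsub>R\<^esub> z),
    on_arr = (\<lambda>f. f \<^bold>*\<^bsub>R\<^esub> \<i>\<d>\<^bsub>R\<^esub> z),
    on_plus = (\<lambda>x y. \<e>\<^bsub>R\<^esub> x y z),
    on_zero = \<n>\<^bsub>R\<^esub> z\<rparr>"

text \<open>
  \<open>R2\<close> is stated through \<open>\<e>\<close>; the corresponding condition that
  \<open>\<d>\<close> is an AC natural isomorphism in its first variable is equivalent to it.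
  Naturality of \<open>\<m>\<close> and \<open>\<n>\<close> is not part of the definition of an AC 2-ring.
\<close>

locale ac_2ring = ac_2group R + monoidal R
  for R :: "('o, 'm, 'r) ring_data_scheme" (structure) +
  assumes d_iso: "\<lbrakk>x \<in> obj R; y \<in> obj R; z \<in> obj R\<rbrakk> \<Longrightarrow>
      \<d> x y z \<in> iso R (x \<otimes> y \<oplus> x \<otimes> z) (x \<otimes> (y \<oplus> z))"
    and d_natural: "\<lbrakk>f \<in> hom R x x'; g \<in> hom R y y'; h \<in> hom R z z'\<rbrakk> \<Longrightarrow>
      \<d> x' y' z' \<bullet> (f \<^bold>* g \<^bold>+ f \<^bold>* h) = (f \<^bold>* (g \<^bold>+ h)) \<bullet> \<d> x y z"
    and e_iso: "\<lbrakk>x \<in> obj R; y \<in> obj R; z \<in> obj R\<rbrakk> \<Longrightarrow>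
      \<e> x y z \<in> iso R (x \<otimes> z \<oplus> y \<otimes> z) ((x \<oplus> y) \<otimes> z)"
    and e_natural: "\<lbrakk>f \<in> hom R x x'; g \<in> hom R y y'; h \<in> hom R z z'\<rbrakk> \<Longrightarrow>
      \<e> x' y' z' \<bullet> (f \<^bold>* h \<^bold>+ g \<^bold>* h) = ((f \<^bold>+ g) \<^bold>* h) \<bullet> \<e> x y z"
    and m_iso: "x \<in> obj R \<Longrightarrow> \<m> x \<in> iso R \<zero> (x \<otimes> \<zero>)"
    and n_iso: "z \<in> obj R \<Longrightarrow> \<n> z \<in> iso R \<zero> (\<zero> \<otimes> z)"
    and left_mult_ac: "x \<in> obj R \<Longrightarrow> ac_endofunctor R (left_mult R x)"
    and right_mult_ac: "z \<in> obj R \<Longrightarrow> ac_endofunctor R (right_mult R z)"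
    and R2: "\<lbrakk>x \<in> obj R; y \<in> obj R\<rbrakk> \<Longrightarrow>
      ac_natural_iso R (left_mult R x \<boxplus> left_mult R y) (left_mult R (x \<oplus> y)) (\<lambda>z. \<e> x y z)"
    and R3: "\<lbrakk>x \<in> obj R; y \<in> obj R\<rbrakk> \<Longrightarrow>
      ac_natural_iso R (left_mult R x \<odot> left_mult R y) (left_mult R (x \<otimes> y)) (\<lambda>z. \<a>\<^sup>\<times> x y z)"
    and R4: "\<lbrakk>x \<in> obj R; z \<in> obj R\<rbrakk> \<Longrightarrow>
      ac_natural_iso R (left_mult R x \<odot> right_mult R z) (right_mult R z \<odot> left_mult R x)
        (\<lambda>y. \<a>\<^sup>\<times> x y z)"
    and R5: "\<lbrakk>y \<in> obj R; z \<in> obj R\<rbrakk> \<Longrightarrow>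
      ac_natural_iso R (right_mult R (y \<otimes> z)) (right_mult R z \<odot> right_mult R y) (\<lambda>x. \<a>\<^sup>\<times> x y z)"
    and R6_l: "ac_natural_iso R (left_mult R \<one>) (endo_id R) (\<lambda>x. \<l>\<^sup>\<times> x)"
    and R6_r: "ac_natural_iso R (right_mult R \<one>) (endo_id R) (\<lambda>x. \<r>\<^sup>\<times> x)"

end

theory Submission
  imports Defs
begin

text \<open>
  Once \<open>left_mult R x\<close> and \<open>right_mult R x\<close> are unfolded, being an AC endofunctor
  amounts to the equations between \<open>\<d>\<close>, \<open>\<e>\<close>, \<open>\<m>\<close>, \<open>\<n>\<close>, \<open>\<b>\<close> and the
  additive unitors, because functoriality and naturality come from the monoidal structure and
  from the naturality of \<open>\<d>\<close> and \<open>\<e>\<close>. Likewise, the remaining equations say that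
  the transformations \<open>\<e>\<close>, \<open>\<a>\<^sup>\<times>\<close>, \<open>\<l>\<^sup>\<times>\<close>, \<open>\<r>\<^sup>\<times>\<close> respect the
  structure isomorphisms for sums. Three things separate these remarks from the theorem.

  The first is that AC natural isomorphisms must also respect the structure isomorphisms at
  zero, of which those equations say nothing. This is automatic
  (\<open>zero_compat_of_plus_compat\<close>): if a transformation \<open>\<tau>\<close> from \<open>F\<close> to \<open>G\<close>
  respects sums, then \<open>\<tau> \<zero> \<bullet> on_zero F\<close> satisfies the unit law that determines
  \<open>on_zero G\<close> uniquely. The same fact gives the naturality of \<open>\<m>\<close> and \<open>\<n>\<close>: an
  arrow \<open>f\<close> from \<open>x\<close> to \<open>x'\<close> induces a transformation \<open>f \<^bold>* -\<close> from
  \<open>left_mult R x\<close> to \<open>left_mult R x'\<close>, which respects sums because \<open>\<d>\<close> is natural in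
  its first variable, and symmetrically for \<open>\<n>\<close>.

  The second is that the endofunctors between which the natural isomorphisms run have to be AC
  endofunctors. Hence these are shown to be closed under composition and sum. For sums
  this is where \<open>AC1\<close> enters, and the unit laws need \<open>\<l>\<^sup>+ \<zero> = \<r>\<^sup>+ \<zero>\<close>.

  The third is that, in the compatibility of \<open>\<e>\<close> with \<open>\<d>\<close>, the condition on AC natural
  isomorphisms and the equation of the theorem have \<open>\<b>\<close> on opposite sides. They agree because
  \<open>\<b>\<close> is its own inverse up to exchanging the two middle arguments (\<open>b_involutive\<close>),
  a consequence of \<open>AC1\<close> for eight objects, half of which are zero.
\<close>

section \<open>Arrows of a groupoid\<close>

context category
begin

text \<open>
  Membership in hom sets is reduced to equations between sources and targets, so that the
  simplifier can discharge the composability conditions of the rules below.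
\<close>

lemma mem_hom_iff [simp]: "f \<in> hom R x y \<longleftrightarrow> f \<in> arr R \<and> src R f = x \<and> trg R f = y"
  by (simp add: hom_def)

lemma src_trg_obj [simp]: "f \<in> arr R \<Longrightarrow> src R f \<in> obj R" "f \<in> arr R \<Longrightarrow> trg R f \<in> obj R"
  by (simp_all add: src_obj trg_obj)

lemma ident_simps [simp]:
  assumes "x \<in> obj R"
  shows "\<i>\<d> x \<in> arr R" "src R (\<i>\<d> x) = x" "trg R (\<i>\<d> x) = x"
  using id_hom[OF assms] by simp_all

lemma cmp_simps [simp]:
  assumes "f \<in> arr R" "g \<in> arr R" "src R g = trg R f"
  shows "g \<bullet> f \<in> arr R" "src R (g \<bullet> f) = src R f" "trg R (g \<bullet> f) = trg R g"
  using comp_hom[of f "src R f" "trg R f" g "trg R g"] assms by simp_all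

lemma cmp_ident [simp]:
  assumes "f \<in> arr R"
  shows "trg R f = x \<Longrightarrow> \<i>\<d> x \<bullet> f = f" "src R f = x \<Longrightarrow> f \<bullet> \<i>\<d> x = f"
  using comp_id_left[of f "src R f" "trg R f"] comp_id_right[of f "src R f" "trg R f"] assms
  by auto

lemma cmp_assoc [simp]:
  assumes "f \<in> arr R" "g \<in> arr R" "h \<in> arr R" "src R g = trg R f" "src R h = trg R g"
  shows "(h \<bullet> g) \<bullet> f = h \<bullet> g \<bullet> f"
  using comp_assoc[of f "src R f" "trg R f" g "trg R g" h "trg R h"] assms by simp

lemma bifunctor_simps:
  assumes "bifunctor R P p"
  shows "x \<in> obj R \<Longrightarrow> y \<in> obj R \<Longrightarrow> P x y \<in> obj R"
    and "f \<in> arr R \<Longrightarrow> g \<in> arr R \<Longrightarrow> p f g \<in> arr R"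
    and "f \<in> arr R \<Longrightarrow> g \<in> arr R \<Longrightarrow> src R (p f g) = P (src R f) (src R g)"
    and "f \<in> arr R \<Longrightarrow> g \<in> arr R \<Longrightarrow> trg R (p f g) = P (trg R f) (trg R g)"
    and "x \<in> obj R \<Longrightarrow> y \<in> obj R \<Longrightarrow> p (\<i>\<d> x) (\<i>\<d> y) = \<i>\<d> (P x y)"
  using assms by (simp_all add: bifunctor_def)

text \<open>
  Oriented so as to merge consecutive arrows: together with right-nested composites, this is the
  form in which the simplifier proves equations that hold by bifunctoriality. The second version
  reaches pairs preceded by a further arrow.
\<close>

lemma bifunctor_interchange:
  assumes "bifunctor R P p"
    and "f \<in> arr R" "f' \<in> arr R" "src R f' = trg R f"
    and "g \<in> arr R" "g' \<in> arr R" "src R g' = trg R g"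
  shows "p f' g' \<bullet> p f g = p (f' \<bullet> f) (g' \<bullet> g)"
  using assms by (simp add: bifunctor_def)

lemma bifunctor_interchange_cmp:
  assumes "bifunctor R P p"
    and "f \<in> arr R" "f' \<in> arr R" "src R f' = trg R f"
    and "g \<in> arr R" "g' \<in> arr R" "src R g' = trg R g"
    and "k \<in> arr R" "trg R k = P (src R f) (src R g)"
  shows "p f' g' \<bullet> p f g \<bullet> k = p (f' \<bullet> f) (g' \<bullet> g) \<bullet> k"
proof -
  have "p f' g' \<bullet> p f g \<bullet> k = (p f' g' \<bullet> p f g) \<bullet> k"
    using assms(2-) by (subst cmp_assoc) (simp_all add: bifunctor_simps[OF assms(1)])
  then show ?thesis
    using bifunctor_interchange[OF assms(1-7)] by simp
qed

end

context groupoid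
begin

lemma iso_eq_hom [simp]: "iso R x y = hom R x y"
  using all_iso by (auto simp: iso_def)

lemma inverse_exists:
  assumes "f \<in> arr R"
  obtains g where "g \<in> arr R" "src R g = trg R f" "trg R g = src R f"
    "g \<bullet> f = \<i>\<d> (src R f)" "f \<bullet> g = \<i>\<d> (trg R f)"
  using all_iso[of f "src R f" "trg R f"] assms unfolding iso_def by auto

lemma cancel_left:
  assumes "g \<bullet> f = g \<bullet> f'"
    and "f \<in> arr R" "f' \<in> arr R" "g \<in> arr R" "src R g = trg R f" "src R g = trg R f'"
  shows "f = f'"
proof -
  obtain h where h: "h \<in> arr R" "src R h = trg R g" "trg R h = src R g" "h \<bullet> g = \<i>\<d> (src R g)"
    using assms(4) by (rule inverse_exists)
  have "(h \<bullet> g) \<bullet> f = (h \<bullet> g) \<bullet> f'"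
    using assms(1) cmp_assoc[of f g h] cmp_assoc[of f' g h] assms(2-) h(1-3) by simp
  then show ?thesis
    using assms(2-) h by simp
qed

lemma cancel_right:
  assumes "f \<bullet> g = f' \<bullet> g"
    and "f \<in> arr R" "f' \<in> arr R" "g \<in> arr R" "src R f = trg R g" "src R f' = trg R g"
  shows "f = f'"
proof -
  obtain h where h: "h \<in> arr R" "trg R h = src R g" "src R h = trg R g" "g \<bullet> h = \<i>\<d> (trg R g)"
    using assms(4) by (rule inverse_exists)
  have "(f \<bullet> g) \<bullet> h = (f' \<bullet> g) \<bullet> h"
    using assms(1) by simp
  then show ?thesis
    using assms(2-) h by simp
qed

lemma inverse_arr_simps [simp]:
  assumes "f \<in> arr R"
  shows "inverse_arr R f \<in> arr R" "src R (inverse_arr R f) = trg R f"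
    "trg R (inverse_arr R f) = src R f" "f \<bullet> inverse_arr R f = \<i>\<d> (trg R f)"
proof -
  obtain g where g: "g \<in> arr R" "src R g = trg R f" "trg R g = src R f"
    "g \<bullet> f = \<i>\<d> (src R f)" "f \<bullet> g = \<i>\<d> (trg R f)"
    using assms by (rule inverse_exists)
  have "inverse_arr R f = g"
    unfolding inverse_arr_def
  proof (rule the_equality)
    show "h = g" if "h \<in> hom R (trg R f) (src R f) \<and> h \<bullet> f = \<i>\<d> (src R f) \<and> f \<bullet> h = \<i>\<d> (trg R f)" for h
      using that g assms by (intro cancel_left[of f h g]) simp_all
  qed (use g in simp)
  then show "inverse_arr R f \<in> arr R" "src R (inverse_arr R f) = trg R f"
    "trg R (inverse_arr R f) = src R f" "f \<bullet> inverse_arr R f = \<i>\<d> (trg R f)"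
    using g by simp_all
qed

end

section \<open>Consequences of the axioms of an AC 2-group\<close>

context ac_2group
begin

lemmas add_simps [simp] = bifunctor_simps[OF add_bifunctor]
lemmas add_interchange = bifunctor_interchange[OF add_bifunctor] bifunctor_interchange_cmp[OF add_bifunctor]

lemma zero_obj [simp]: "\<zero> \<in> obj R"
  by (rule zero_in_obj)

lemma b_simps [simp]:
  assumes "x \<in> obj R" "y \<in> obj R" "z \<in> obj R" "t \<in> obj R"
  shows "\<b> x y z t \<in> arr R"
    and "src R (\<b> x y z t) = (x \<oplus> y) \<oplus> (z \<oplus> t)"
    and "trg R (\<b> x y z t) = (x \<oplus> z) \<oplus> (y \<oplus> t)"
  using b_iso[OF assms] by simp_all

lemma unitor_simps [simp]:
  assumes "x \<in> obj R"
  shows "\<l>\<^sup>+ x \<in> arr R" "src R (\<l>\<^sup>+ x) = \<zero> \<oplus> x" "trg R (\<l>\<^sup>+ x) = x"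
    and "\<r>\<^sup>+ x \<in> arr R" "src R (\<r>\<^sup>+ x) = x \<oplus> \<zero>" "trg R (\<r>\<^sup>+ x) = x"
  using add_l_iso[OF assms] add_r_iso[OF assms] by simp_all

lemma b_natural_cmp:
  assumes "f \<in> hom R x x'" "g \<in> hom R y y'" "h \<in> hom R z z'" "k \<in> hom R t t'"
    and "q \<in> arr R" "trg R q = (x \<oplus> y) \<oplus> (z \<oplus> t)"
  shows "\<b> x' y' z' t' \<bullet> ((f \<^bold>+ g) \<^bold>+ (h \<^bold>+ k)) \<bullet> q = ((f \<^bold>+ h) \<^bold>+ (g \<^bold>+ k)) \<bullet> \<b> x y z t \<bullet> q"
proof -
  have "(\<b> x' y' z' t' \<bullet> ((f \<^bold>+ g) \<^bold>+ (h \<^bold>+ k))) \<bullet> q = (((f \<^bold>+ h) \<^bold>+ (g \<^bold>+ k)) \<bullet> \<b> x y z t) \<bullet> q"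
    using b_natural[OF assms(1-4)] by simp
  then show ?thesis
    using assms by auto
qed

text \<open>The left unitors make \<open>\<zero> \<oplus> -\<close> naturally isomorphic to the identity, hence faithful.\<close>

lemma add_zero_left_inject:
  assumes "\<i>\<d> \<zero> \<^bold>+ f = \<i>\<d> \<zero> \<^bold>+ g"
    and "f \<in> arr R" "g \<in> arr R" "src R f = src R g" "trg R f = trg R g"
  shows "f = g"
proof (rule cancel_right)
  show "f \<bullet> \<l>\<^sup>+ (src R f) = g \<bullet> \<l>\<^sup>+ (src R f)"
    using add_l_natural[of f "src R f" "trg R f"] add_l_natural[of g "src R g" "trg R g"] assms
    by simp
qed (use assms in simp_all)

text \<open>
  By \<open>AC3\<close>, \<open>\<b> \<zero> \<zero> \<zero> \<zero>\<close> is an identity, so \<open>AC2_r\<close> at zero relates the two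
  unitors directly. It yields the equality after adding an identity on the left.
\<close>

lemma l_zero_eq_r_zero: "\<l>\<^sup>+ \<zero> = \<r>\<^sup>+ \<zero>"
proof -
  \<comment> \<open>naturality of \<open>\<r>\<^sup>+\<close> at \<open>\<r>\<^sup>+ \<zero>\<close> itself, where that arrow can be cancelled\<close>
  have r: "\<r>\<^sup>+ (\<zero> \<oplus> \<zero>) = \<r>\<^sup>+ \<zero> \<^bold>+ \<i>\<d> \<zero>"
  proof (rule cancel_left)
    show "\<r>\<^sup>+ \<zero> \<bullet> \<r>\<^sup>+ (\<zero> \<oplus> \<zero>) = \<r>\<^sup>+ \<zero> \<bullet> (\<r>\<^sup>+ \<zero> \<^bold>+ \<i>\<d> \<zero>)"
      using add_r_natural[of "\<r>\<^sup>+ \<zero>" "\<zero> \<oplus> \<zero>" \<zero>] by simp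
  qed simp_all
  have "(\<r>\<^sup>+ \<zero> \<^bold>+ \<i>\<d> \<zero>) \<bullet> (\<i>\<d> (\<zero> \<oplus> \<zero>) \<^bold>+ \<l>\<^sup>+ \<zero>) = \<r>\<^sup>+ \<zero> \<^bold>+ \<r>\<^sup>+ \<zero>"
    using AC2_r[of \<zero> \<zero>] AC3[of \<zero> \<zero>] r by simp
  also have "\<dots> = (\<r>\<^sup>+ \<zero> \<^bold>+ \<i>\<d> \<zero>) \<bullet> (\<i>\<d> (\<zero> \<oplus> \<zero>) \<^bold>+ \<r>\<^sup>+ \<zero>)"
    by (simp add: add_interchange)
  finally have eq: "\<i>\<d> (\<zero> \<oplus> \<zero>) \<^bold>+ \<l>\<^sup>+ \<zero> = \<i>\<d> (\<zero> \<oplus> \<zero>) \<^bold>+ \<r>\<^sup>+ \<zero>"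
    by (rule cancel_left) simp_all
  \<comment> \<open>moves the left summand from \<open>\<zero> \<oplus> \<zero>\<close> to \<open>\<zero>\<close>, where \<open>\<l>\<^sup>+\<close> is available\<close>
  have slide: "(\<r>\<^sup>+ \<zero> \<^bold>+ \<i>\<d> \<zero>) \<bullet> (\<i>\<d> (\<zero> \<oplus> \<zero>) \<^bold>+ f) = (\<i>\<d> \<zero> \<^bold>+ f) \<bullet> (\<r>\<^sup>+ \<zero> \<^bold>+ \<i>\<d> (\<zero> \<oplus> \<zero>))"
    if "f \<in> hom R (\<zero> \<oplus> \<zero>) \<zero>" for f
    using that by (simp add: add_interchange)
  have "(\<i>\<d> \<zero> \<^bold>+ \<l>\<^sup>+ \<zero>) \<bullet> (\<r>\<^sup>+ \<zero> \<^bold>+ \<i>\<d> (\<zero> \<oplus> \<zero>)) = (\<i>\<d> \<zero> \<^bold>+ \<r>\<^sup>+ \<zero>) \<bullet> (\<r>\<^sup>+ \<zero> \<^bold>+ \<i>\<d> (\<zero> \<oplus> \<zero>))"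
    using slide[of "\<l>\<^sup>+ \<zero>"] slide[of "\<r>\<^sup>+ \<zero>"] eq by simp
  then have "\<i>\<d> \<zero> \<^bold>+ \<l>\<^sup>+ \<zero> = \<i>\<d> \<zero> \<^bold>+ \<r>\<^sup>+ \<zero>"
    by (rule cancel_right) simp_all
  then show ?thesis
    by (rule add_zero_left_inject) simp_all
qed

text \<open>
  View the eight arguments of \<open>AC1\<close> as the corners of a cube, and put \<open>x\<close>, \<open>y\<close>,
  \<open>z\<close>, \<open>t\<close> on four of them and zero on the others so that, up to unitors, the two outer
  factors of the right-hand side become the two maps to be composed. Its middle factor is then a
  sum of identities by \<open>AC3\<close>. On the left-hand side the middle factor is an identity up to
  unitors, again by \<open>AC3\<close>, and the other two are absorbed into unitors by the four equations
  \<open>AC2\<close>. So composing with both maps does not change the isomorphism \<open>?U\<close> that removes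
  all the zeros.
\<close>

lemma b_involutive:
  assumes [simp]: "x \<in> obj R" "y \<in> obj R" "z \<in> obj R" "t \<in> obj R"
  shows "\<b> x z y t \<bullet> \<b> x y z t = \<i>\<d> ((x \<oplus> y) \<oplus> (z \<oplus> t))"
proof -
  let ?U = "(\<r>\<^sup>+ x \<^bold>+ \<r>\<^sup>+ y) \<^bold>+ (\<l>\<^sup>+ z \<^bold>+ \<l>\<^sup>+ t)"
  let ?k = "\<b> x \<zero> y \<zero> \<^bold>+ \<b> \<zero> z \<zero> t"
  \<comment> \<open>\<open>\<b>\<close> exchanges the two middle arrows, which is harmless as \<open>\<l>\<^sup>+ \<zero> = \<r>\<^sup>+ \<zero>\<close>\<close>
  have mid: "((\<i>\<d> (x \<oplus> y) \<^bold>+ \<l>\<^sup>+ \<zero>) \<^bold>+ (\<r>\<^sup>+ \<zero> \<^bold>+ \<i>\<d> (z \<oplus> t)))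
        \<bullet> \<b> (x \<oplus> y) (\<zero> \<oplus> \<zero>) (\<zero> \<oplus> \<zero>) (z \<oplus> t)
      = (\<i>\<d> (x \<oplus> y) \<^bold>+ \<l>\<^sup>+ \<zero>) \<^bold>+ (\<r>\<^sup>+ \<zero> \<^bold>+ \<i>\<d> (z \<oplus> t))"
    using b_natural[of "\<i>\<d> (x \<oplus> y)" "x \<oplus> y" "x \<oplus> y" "\<l>\<^sup>+ \<zero>" "\<zero> \<oplus> \<zero>" \<zero>
        "\<l>\<^sup>+ \<zero>" "\<zero> \<oplus> \<zero>" \<zero> "\<i>\<d> (z \<oplus> t)" "z \<oplus> t" "z \<oplus> t"]
      AC3[of "x \<oplus> y" "z \<oplus> t"]
    by (simp add: l_zero_eq_r_zero)
  have "\<b> x z y t \<bullet> \<b> x y z t \<bullet> ?U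
     = ?U \<bullet> \<b> (x \<oplus> \<zero>) (\<zero> \<oplus> z) (y \<oplus> \<zero>) (\<zero> \<oplus> t) \<bullet> \<b> (x \<oplus> \<zero>) (y \<oplus> \<zero>) (\<zero> \<oplus> z) (\<zero> \<oplus> t)"
    by (simp add: b_natural[where x = "x \<oplus> \<zero>" and y = "y \<oplus> \<zero>" and z = "\<zero> \<oplus> z" and t = "\<zero> \<oplus> t"]
        b_natural_cmp[where x = "x \<oplus> \<zero>" and z = "y \<oplus> \<zero>" and y = "\<zero> \<oplus> z" and t = "\<zero> \<oplus> t"])
  also have "\<dots> = ?U \<bullet> (\<b> x y \<zero> \<zero> \<^bold>+ \<b> \<zero> \<zero> z t)
      \<bullet> \<b> (x \<oplus> y) (\<zero> \<oplus> \<zero>) (\<zero> \<oplus> \<zero>) (z \<oplus> t) \<bullet> ?k"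
    using AC1[of x \<zero> y \<zero> \<zero> z \<zero> t] AC3[of x z] AC3[of y t] by simp
  also have "\<dots> = (\<r>\<^sup>+ (x \<oplus> y) \<^bold>+ \<l>\<^sup>+ (z \<oplus> t))
      \<bullet> (((\<i>\<d> (x \<oplus> y) \<^bold>+ \<l>\<^sup>+ \<zero>) \<^bold>+ (\<r>\<^sup>+ \<zero> \<^bold>+ \<i>\<d> (z \<oplus> t)))
        \<bullet> \<b> (x \<oplus> y) (\<zero> \<oplus> \<zero>) (\<zero> \<oplus> \<zero>) (z \<oplus> t)) \<bullet> ?k"
    by (simp add: add_interchange AC2_r' AC2_l')
  also have "\<dots> = ?U"
    unfolding mid by (simp add: add_interchange AC2_r AC2_l)
  finally have "(\<b> x z y t \<bullet> \<b> x y z t) \<bullet> ?U = \<i>\<d> ((x \<oplus> y) \<oplus> (z \<oplus> t)) \<bullet> ?U"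
    by simp
  then show ?thesis
    by (rule cancel_right) simp_all
qed

end
section \<open>AC endofunctors: identity, composition and sum\<close>

context ac_endofunctor
begin

lemma on_simps [simp]:
  shows "x \<in> obj R \<Longrightarrow> on_obj F x \<in> obj R"
    and "f \<in> arr R \<Longrightarrow> on_arr F f \<in> arr R"
    and "f \<in> arr R \<Longrightarrow> src R (on_arr F f) = on_obj F (src R f)"
    and "f \<in> arr R \<Longrightarrow> trg R (on_arr F f) = on_obj F (trg R f)"
    and "x \<in> obj R \<Longrightarrow> on_arr F (\<i>\<d> x) = \<i>\<d> (on_obj F x)"
  using on_obj on_id on_arr by simp_all

lemma on_plus_simps [simp]:
  assumes "x \<in> obj R" "y \<in> obj R"
  shows "on_plus F x y \<in> arr R"
    and "src R (on_plus F x y) = on_obj F x \<oplus> on_obj F y"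
    and "trg R (on_plus F x y) = on_obj F (x \<oplus> y)"
  using plus_iso[OF assms] by simp_all

lemma on_zero_simps [simp]:
  "on_zero F \<in> arr R" "src R (on_zero F) = \<zero>" "trg R (on_zero F) = on_obj F \<zero>"
  using zero_iso by simp_all

lemma on_arr_cmp:
  assumes "f \<in> arr R" "g \<in> arr R" "src R g = trg R f"
  shows "on_arr F (g \<bullet> f) = on_arr F g \<bullet> on_arr F f"
  using on_comp[of f _ _ g] assms by simp

lemma plus_natural_cmp:
  assumes "f \<in> hom R x x'" "g \<in> hom R y y'" "q \<in> arr R" "trg R q = on_obj F x \<oplus> on_obj F y"
  shows "on_plus F x' y' \<bullet> (on_arr F f \<^bold>+ on_arr F g) \<bullet> q = on_arr F (f \<^bold>+ g) \<bullet> on_plus F x y \<bullet> q"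
proof -
  have "(on_plus F x' y' \<bullet> (on_arr F f \<^bold>+ on_arr F g)) \<bullet> q = (on_arr F (f \<^bold>+ g) \<bullet> on_plus F x y) \<bullet> q"
    using plus_natural[OF assms(1,2)] by simp
  then show ?thesis
    using assms by auto
qed

end

context ac_2group
begin

lemma endo_id_simps [simp]:
  "on_obj (endo_id R) x = x"
  "on_arr (endo_id R) f = f"
  "on_plus (endo_id R) x y = \<i>\<d> (x \<oplus> y)"
  "on_zero (endo_id R) = \<i>\<d> \<zero>"
  by (simp_all add: endo_id_def)

lemma endo_comp_simps [simp]:
  "on_obj (F \<odot> G) x = on_obj F (on_obj G x)"
  "on_arr (F \<odot> G) f = on_arr F (on_arr G f)"
  "on_plus (F \<odot> G) x y = on_arr F (on_plus G x y) \<bullet> on_plus F (on_obj G x) (on_obj G y)"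
  "on_zero (F \<odot> G) = on_arr F (on_zero G) \<bullet> on_zero F"
  by (simp_all add: endo_comp_def)

lemma endo_sum_simps [simp]:
  "on_obj (F \<boxplus> G) x = on_obj F x \<oplus> on_obj G x"
  "on_arr (F \<boxplus> G) f = on_arr F f \<^bold>+ on_arr G f"
  "on_plus (F \<boxplus> G) x y =
    (on_plus F x y \<^bold>+ on_plus G x y) \<bullet> \<b> (on_obj F x) (on_obj G x) (on_obj F y) (on_obj G y)"
  "on_zero (F \<boxplus> G) = (on_zero F \<^bold>+ on_zero G) \<bullet> inverse_arr R (\<l>\<^sup>+ \<zero>)"
  by (simp_all add: endo_sum_def)

lemma endo_id_ac: "ac_endofunctor R (endo_id R)"
  by unfold_locales auto

text \<open>
  For compatibility with \<open>\<b>\<close>, the naturality of \<open>on_plus F\<close> moves the images of the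
  arrows \<open>on_plus G\<close> to the left, the condition for \<open>F\<close> turns \<open>\<b>\<close> into its
  image, and the condition for \<open>G\<close> then applies under \<open>F\<close>. The unit laws follow the
  same pattern.
\<close>

lemma endo_comp_ac:
  assumes "ac_endofunctor R F" "ac_endofunctor R G"
  shows "ac_endofunctor R (F \<odot> G)"
proof -
  interpret F: ac_endofunctor R F by fact
  interpret G: ac_endofunctor R G by fact
  let ?P = "on_plus F" and ?Q = "on_plus G"
  let ?F = "on_obj F" and ?G = "on_obj G"
  show ?thesis
  proof (unfold_locales; unfold endo_comp_simps)
    fix f g x x' y y'
    assume f: "f \<in> hom R x x'" and g: "g \<in> hom R y y'"
    let ?f = "on_arr G f" and ?g = "on_arr G g"
    have [simp]: "f \<in> arr R" "g \<in> arr R" "x \<in> obj R" "x' \<in> obj R" "y \<in> obj R" "y' \<in> obj R"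
      using f g by auto
    have "(on_arr F (?Q x' y') \<bullet> ?P (?G x') (?G y')) \<bullet> (on_arr F ?f \<^bold>+ on_arr F ?g)
       = on_arr F (?Q x' y' \<bullet> (?f \<^bold>+ ?g)) \<bullet> ?P (?G x) (?G y)"
      using f g F.plus_natural[of ?f "?G x" "?G x'" ?g "?G y" "?G y'"] by (auto simp: F.on_arr_cmp)
    also have "\<dots> = on_arr F (on_arr G (f \<^bold>+ g)) \<bullet> on_arr F (?Q x y) \<bullet> ?P (?G x) (?G y)"
      using f g by (auto simp: F.on_arr_cmp G.plus_natural[OF f g])
    finally show "(on_arr F (?Q x' y') \<bullet> ?P (?G x') (?G y')) \<bullet> (on_arr F ?f \<^bold>+ on_arr F ?g) = \<dots>" .
  next
    fix x y z t
    assume [simp]: "x \<in> obj R" "y \<in> obj R" "z \<in> obj R" "t \<in> obj R"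
    let ?b = "\<b> (?F (?G x)) (?F (?G y)) (?F (?G z)) (?F (?G t))"
    have "(on_arr F (?Q (x \<oplus> z) (y \<oplus> t)) \<bullet> ?P (?G (x \<oplus> z)) (?G (y \<oplus> t)))
          \<bullet> ((on_arr F (?Q x z) \<bullet> ?P (?G x) (?G z)) \<^bold>+ (on_arr F (?Q y t) \<bullet> ?P (?G y) (?G t))) \<bullet> ?b
      = on_arr F (?Q (x \<oplus> z) (y \<oplus> t)) \<bullet> ?P (?G (x \<oplus> z)) (?G (y \<oplus> t))
          \<bullet> (on_arr F (?Q x z) \<^bold>+ on_arr F (?Q y t)) \<bullet> (?P (?G x) (?G z) \<^bold>+ ?P (?G y) (?G t)) \<bullet> ?b"
      by (simp add: add_interchange)
    also have "\<dots> = on_arr F (?Q (x \<oplus> z) (y \<oplus> t)) \<bullet> on_arr F (?Q x z \<^bold>+ ?Q y t)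
          \<bullet> ?P (?G x \<oplus> ?G z) (?G y \<oplus> ?G t) \<bullet> (?P (?G x) (?G z) \<^bold>+ ?P (?G y) (?G t)) \<bullet> ?b"
      by (simp add: F.plus_natural_cmp[where x = "?G x \<oplus> ?G z" and y = "?G y \<oplus> ?G t"])
    also have "\<dots> = on_arr F (?Q (x \<oplus> z) (y \<oplus> t) \<bullet> (?Q x z \<^bold>+ ?Q y t) \<bullet> \<b> (?G x) (?G y) (?G z) (?G t))
          \<bullet> ?P (?G x \<oplus> ?G y) (?G z \<oplus> ?G t) \<bullet> (?P (?G x) (?G y) \<^bold>+ ?P (?G z) (?G t))"
      by (simp add: F.on_arr_cmp F.plus_b)
    also have "\<dots> = on_arr F (on_arr G (\<b> x y z t)) \<bullet> on_arr F (?Q (x \<oplus> y) (z \<oplus> t))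
          \<bullet> on_arr F (?Q x y \<^bold>+ ?Q z t)
          \<bullet> ?P (?G x \<oplus> ?G y) (?G z \<oplus> ?G t) \<bullet> (?P (?G x) (?G y) \<^bold>+ ?P (?G z) (?G t))"
      by (simp add: F.on_arr_cmp G.plus_b)
    also have "\<dots> = on_arr F (on_arr G (\<b> x y z t)) \<bullet> on_arr F (?Q (x \<oplus> y) (z \<oplus> t))
          \<bullet> ?P (?G (x \<oplus> y)) (?G (z \<oplus> t)) \<bullet> (on_arr F (?Q x y) \<^bold>+ on_arr F (?Q z t))
          \<bullet> (?P (?G x) (?G y) \<^bold>+ ?P (?G z) (?G t))"
      by (simp add: F.plus_natural_cmp[where x = "?G x \<oplus> ?G y" and y = "?G z \<oplus> ?G t"])
    also have "\<dots> = on_arr F (on_arr G (\<b> x y z t))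
          \<bullet> (on_arr F (?Q (x \<oplus> y) (z \<oplus> t)) \<bullet> ?P (?G (x \<oplus> y)) (?G (z \<oplus> t)))
          \<bullet> ((on_arr F (?Q x y) \<bullet> ?P (?G x) (?G y)) \<^bold>+ (on_arr F (?Q z t) \<bullet> ?P (?G z) (?G t)))"
      by (simp add: add_interchange)
    finally show "(on_arr F (?Q (x \<oplus> z) (y \<oplus> t)) \<bullet> ?P (?G (x \<oplus> z)) (?G (y \<oplus> t)))
          \<bullet> ((on_arr F (?Q x z) \<bullet> ?P (?G x) (?G z)) \<^bold>+ (on_arr F (?Q y t) \<bullet> ?P (?G y) (?G t))) \<bullet> ?b = \<dots>" .
  next
    fix x
    assume [simp]: "x \<in> obj R"
    have "on_arr F (on_arr G (\<l>\<^sup>+ x)) \<bullet> (on_arr F (?Q \<zero> x) \<bullet> ?P (?G \<zero>) (?G x))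
          \<bullet> ((on_arr F (on_zero G) \<bullet> on_zero F) \<^bold>+ \<i>\<d> (?F (?G x)))
      = on_arr F (on_arr G (\<l>\<^sup>+ x)) \<bullet> on_arr F (?Q \<zero> x) \<bullet> ?P (?G \<zero>) (?G x)
          \<bullet> (on_arr F (on_zero G) \<^bold>+ on_arr F (\<i>\<d> (?G x))) \<bullet> (on_zero F \<^bold>+ \<i>\<d> (?F (?G x)))"
      by (simp add: add_interchange)
    also have "\<dots> = on_arr F (on_arr G (\<l>\<^sup>+ x) \<bullet> ?Q \<zero> x \<bullet> (on_zero G \<^bold>+ \<i>\<d> (?G x)))
          \<bullet> ?P \<zero> (?G x) \<bullet> (on_zero F \<^bold>+ \<i>\<d> (?F (?G x)))"
      by (simp add: F.plus_natural_cmp[where x = \<zero> and y = "?G x"] F.on_arr_cmp del: F.on_simps(5))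
    also have "\<dots> = \<l>\<^sup>+ (?F (?G x))"
      by (simp add: G.plus_l F.plus_l)
    finally show "on_arr F (on_arr G (\<l>\<^sup>+ x)) \<bullet> (on_arr F (?Q \<zero> x) \<bullet> ?P (?G \<zero>) (?G x))
          \<bullet> ((on_arr F (on_zero G) \<bullet> on_zero F) \<^bold>+ \<i>\<d> (?F (?G x))) = \<l>\<^sup>+ (?F (?G x))" .
  next
    fix x
    assume [simp]: "x \<in> obj R"
    have "on_arr F (on_arr G (\<r>\<^sup>+ x)) \<bullet> (on_arr F (?Q x \<zero>) \<bullet> ?P (?G x) (?G \<zero>))
          \<bullet> (\<i>\<d> (?F (?G x)) \<^bold>+ (on_arr F (on_zero G) \<bullet> on_zero F))
      = on_arr F (on_arr G (\<r>\<^sup>+ x)) \<bullet> on_arr F (?Q x \<zero>) \<bullet> ?P (?G x) (?G \<zero>)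
          \<bullet> (on_arr F (\<i>\<d> (?G x)) \<^bold>+ on_arr F (on_zero G)) \<bullet> (\<i>\<d> (?F (?G x)) \<^bold>+ on_zero F)"
      by (simp add: add_interchange)
    also have "\<dots> = on_arr F (on_arr G (\<r>\<^sup>+ x) \<bullet> ?Q x \<zero> \<bullet> (\<i>\<d> (?G x) \<^bold>+ on_zero G))
          \<bullet> ?P (?G x) \<zero> \<bullet> (\<i>\<d> (?F (?G x)) \<^bold>+ on_zero F)"
      by (simp add: F.plus_natural_cmp[where y = \<zero> and x = "?G x"] F.on_arr_cmp del: F.on_simps(5))
    also have "\<dots> = \<r>\<^sup>+ (?F (?G x))"
      by (simp add: G.plus_r F.plus_r)
    finally show "on_arr F (on_arr G (\<r>\<^sup>+ x)) \<bullet> (on_arr F (?Q x \<zero>) \<bullet> ?P (?G x) (?G \<zero>))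
          \<bullet> (\<i>\<d> (?F (?G x)) \<^bold>+ (on_arr F (on_zero G) \<bullet> on_zero F)) = \<r>\<^sup>+ (?F (?G x))" .
  qed (auto simp: F.on_arr_cmp G.on_arr_cmp)
qed

text \<open>
  The structure isomorphisms of the sum contain instances of \<open>\<b>\<close>. Naturality of \<open>\<b>\<close>
  brings those on the left-hand side together, and \<open>AC1\<close> replaces them by the ones for which
  the conditions for \<open>F\<close> and \<open>G\<close> apply in separate summands. In the unit laws, naturality
  leaves \<open>\<b> \<zero> \<zero> - -\<close> or \<open>\<b> - - \<zero> \<zero>\<close>, which \<open>AC2_l'\<close> and \<open>AC2_r'\<close>
  turn into unitors; the inverse of \<open>\<l>\<^sup>+ \<zero>\<close> in \<open>on_zero\<close> cancels what is left.
\<close>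

lemma endo_sum_ac:
  assumes "ac_endofunctor R F" "ac_endofunctor R G"
  shows "ac_endofunctor R (F \<boxplus> G)"
proof -
  interpret F: ac_endofunctor R F by fact
  interpret G: ac_endofunctor R G by fact
  let ?P = "on_plus F" and ?Q = "on_plus G"
  let ?F = "on_obj F" and ?G = "on_obj G"
  show ?thesis
  proof (unfold_locales; unfold endo_sum_simps)
    fix f g x x' y y'
    assume f: "f \<in> hom R x x'" and g: "g \<in> hom R y y'"
    have [simp]: "f \<in> arr R" "g \<in> arr R" "x \<in> obj R" "x' \<in> obj R" "y \<in> obj R" "y' \<in> obj R"
      and [simp]: "src R f = x" "trg R f = x'" "src R g = y" "trg R g = y'"
      using f g by auto
    have "((?P x' y' \<^bold>+ ?Q x' y') \<bullet> \<b> (?F x') (?G x') (?F y') (?G y'))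
          \<bullet> ((on_arr F f \<^bold>+ on_arr G f) \<^bold>+ (on_arr F g \<^bold>+ on_arr G g))
      = ((?P x' y' \<bullet> (on_arr F f \<^bold>+ on_arr F g)) \<^bold>+ (?Q x' y' \<bullet> (on_arr G f \<^bold>+ on_arr G g)))
          \<bullet> \<b> (?F x) (?G x) (?F y) (?G y)"
      by (simp add: b_natural[where x = "?F x" and y = "?G x" and z = "?F y" and t = "?G y"]
          add_interchange)
    also have "\<dots> = (on_arr F (f \<^bold>+ g) \<^bold>+ on_arr G (f \<^bold>+ g))
          \<bullet> (?P x y \<^bold>+ ?Q x y) \<bullet> \<b> (?F x) (?G x) (?F y) (?G y)"
      by (simp add: F.plus_natural[OF f g] G.plus_natural[OF f g] add_interchange)
    finally show "((?P x' y' \<^bold>+ ?Q x' y') \<bullet> \<b> (?F x') (?G x') (?F y') (?G y'))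
          \<bullet> ((on_arr F f \<^bold>+ on_arr G f) \<^bold>+ (on_arr F g \<^bold>+ on_arr G g)) = \<dots>" .
  next
    fix x y z t
    assume [simp]: "x \<in> obj R" "y \<in> obj R" "z \<in> obj R" "t \<in> obj R"
    let ?B = "\<b> (?F x \<oplus> ?G x) (?F y \<oplus> ?G y) (?F z \<oplus> ?G z) (?F t \<oplus> ?G t)"
    let ?B' = "\<b> (?F x \<oplus> ?F y) (?G x \<oplus> ?G y) (?F z \<oplus> ?F t) (?G z \<oplus> ?G t)"
    let ?c = "\<b> (?F x) (?G x) (?F z) (?G z) \<^bold>+ \<b> (?F y) (?G y) (?F t) (?G t)"
    let ?c' = "\<b> (?F x) (?G x) (?F y) (?G y) \<^bold>+ \<b> (?F z) (?G z) (?F t) (?G t)"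
    have "((?P (x \<oplus> z) (y \<oplus> t) \<^bold>+ ?Q (x \<oplus> z) (y \<oplus> t))
            \<bullet> \<b> (?F (x \<oplus> z)) (?G (x \<oplus> z)) (?F (y \<oplus> t)) (?G (y \<oplus> t)))
          \<bullet> (((?P x z \<^bold>+ ?Q x z) \<bullet> \<b> (?F x) (?G x) (?F z) (?G z))
            \<^bold>+ ((?P y t \<^bold>+ ?Q y t) \<bullet> \<b> (?F y) (?G y) (?F t) (?G t))) \<bullet> ?B
      = (?P (x \<oplus> z) (y \<oplus> t) \<^bold>+ ?Q (x \<oplus> z) (y \<oplus> t))
          \<bullet> \<b> (?F (x \<oplus> z)) (?G (x \<oplus> z)) (?F (y \<oplus> t)) (?G (y \<oplus> t))
          \<bullet> ((?P x z \<^bold>+ ?Q x z) \<^bold>+ (?P y t \<^bold>+ ?Q y t)) \<bullet> ?c \<bullet> ?B"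
      by (simp add: add_interchange)
    also have "\<dots> = (?P (x \<oplus> z) (y \<oplus> t) \<^bold>+ ?Q (x \<oplus> z) (y \<oplus> t))
          \<bullet> ((?P x z \<^bold>+ ?P y t) \<^bold>+ (?Q x z \<^bold>+ ?Q y t))
          \<bullet> \<b> (?F x \<oplus> ?F z) (?G x \<oplus> ?G z) (?F y \<oplus> ?F t) (?G y \<oplus> ?G t) \<bullet> ?c \<bullet> ?B"
      by (simp add: b_natural_cmp[where x = "?F x \<oplus> ?F z" and y = "?G x \<oplus> ?G z"
            and z = "?F y \<oplus> ?F t" and t = "?G y \<oplus> ?G t"])
    also have "\<dots> = (?P (x \<oplus> z) (y \<oplus> t) \<^bold>+ ?Q (x \<oplus> z) (y \<oplus> t))
          \<bullet> ((?P x z \<^bold>+ ?P y t) \<^bold>+ (?Q x z \<^bold>+ ?Q y t))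
          \<bullet> (\<b> (?F x) (?F y) (?F z) (?F t) \<^bold>+ \<b> (?G x) (?G y) (?G z) (?G t)) \<bullet> ?B' \<bullet> ?c'"
      by (simp add: AC1)
    also have "\<dots>
      = ((?P (x \<oplus> z) (y \<oplus> t) \<bullet> (?P x z \<^bold>+ ?P y t) \<bullet> \<b> (?F x) (?F y) (?F z) (?F t))
          \<^bold>+ (?Q (x \<oplus> z) (y \<oplus> t) \<bullet> (?Q x z \<^bold>+ ?Q y t) \<bullet> \<b> (?G x) (?G y) (?G z) (?G t))) \<bullet> ?B' \<bullet> ?c'"
      by (simp add: add_interchange)
    also have "\<dots>
      = ((on_arr F (\<b> x y z t) \<bullet> ?P (x \<oplus> y) (z \<oplus> t) \<bullet> (?P x y \<^bold>+ ?P z t))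
          \<^bold>+ (on_arr G (\<b> x y z t) \<bullet> ?Q (x \<oplus> y) (z \<oplus> t) \<bullet> (?Q x y \<^bold>+ ?Q z t))) \<bullet> ?B' \<bullet> ?c'"
      by (simp only: F.plus_b G.plus_b \<open>x \<in> obj R\<close> \<open>y \<in> obj R\<close> \<open>z \<in> obj R\<close> \<open>t \<in> obj R\<close>)
    also have "\<dots> = (on_arr F (\<b> x y z t) \<^bold>+ on_arr G (\<b> x y z t))
          \<bullet> (?P (x \<oplus> y) (z \<oplus> t) \<^bold>+ ?Q (x \<oplus> y) (z \<oplus> t))
          \<bullet> ((?P x y \<^bold>+ ?P z t) \<^bold>+ (?Q x y \<^bold>+ ?Q z t)) \<bullet> ?B' \<bullet> ?c'"
      by (simp add: add_interchange)
    also have "\<dots> = (on_arr F (\<b> x y z t) \<^bold>+ on_arr G (\<b> x y z t))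
          \<bullet> (?P (x \<oplus> y) (z \<oplus> t) \<^bold>+ ?Q (x \<oplus> y) (z \<oplus> t))
          \<bullet> \<b> (?F (x \<oplus> y)) (?G (x \<oplus> y)) (?F (z \<oplus> t)) (?G (z \<oplus> t))
          \<bullet> ((?P x y \<^bold>+ ?Q x y) \<^bold>+ (?P z t \<^bold>+ ?Q z t)) \<bullet> ?c'"
      by (simp add: b_natural_cmp[where x = "?F x \<oplus> ?F y" and y = "?G x \<oplus> ?G y"
            and z = "?F z \<oplus> ?F t" and t = "?G z \<oplus> ?G t"])
    also have "\<dots> = (on_arr F (\<b> x y z t) \<^bold>+ on_arr G (\<b> x y z t))
          \<bullet> ((?P (x \<oplus> y) (z \<oplus> t) \<^bold>+ ?Q (x \<oplus> y) (z \<oplus> t))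
            \<bullet> \<b> (?F (x \<oplus> y)) (?G (x \<oplus> y)) (?F (z \<oplus> t)) (?G (z \<oplus> t)))
          \<bullet> (((?P x y \<^bold>+ ?Q x y) \<bullet> \<b> (?F x) (?G x) (?F y) (?G y))
            \<^bold>+ ((?P z t \<^bold>+ ?Q z t) \<bullet> \<b> (?F z) (?G z) (?F t) (?G t)))"
      by (simp add: add_interchange)
    finally show "((?P (x \<oplus> z) (y \<oplus> t) \<^bold>+ ?Q (x \<oplus> z) (y \<oplus> t))
            \<bullet> \<b> (?F (x \<oplus> z)) (?G (x \<oplus> z)) (?F (y \<oplus> t)) (?G (y \<oplus> t)))
          \<bullet> (((?P x z \<^bold>+ ?Q x z) \<bullet> \<b> (?F x) (?G x) (?F z) (?G z))
            \<^bold>+ ((?P y t \<^bold>+ ?Q y t) \<bullet> \<b> (?F y) (?G y) (?F t) (?G t))) \<bullet> ?B = \<dots>" .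
  next
    fix x
    assume [simp]: "x \<in> obj R"
    let ?i = "inverse_arr R (\<l>\<^sup>+ \<zero>)"
    have "(on_arr F (\<l>\<^sup>+ x) \<^bold>+ on_arr G (\<l>\<^sup>+ x))
          \<bullet> ((?P \<zero> x \<^bold>+ ?Q \<zero> x) \<bullet> \<b> (?F \<zero>) (?G \<zero>) (?F x) (?G x))
          \<bullet> (((on_zero F \<^bold>+ on_zero G) \<bullet> ?i) \<^bold>+ \<i>\<d> (?F x \<oplus> ?G x))
      = (on_arr F (\<l>\<^sup>+ x) \<^bold>+ on_arr G (\<l>\<^sup>+ x)) \<bullet> (?P \<zero> x \<^bold>+ ?Q \<zero> x)
          \<bullet> \<b> (?F \<zero>) (?G \<zero>) (?F x) (?G x)
          \<bullet> ((on_zero F \<^bold>+ on_zero G) \<^bold>+ (\<i>\<d> (?F x) \<^bold>+ \<i>\<d> (?G x)))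
          \<bullet> (?i \<^bold>+ \<i>\<d> (?F x \<oplus> ?G x))"
      by (simp add: add_interchange)
    also have "\<dots> = (((on_arr F (\<l>\<^sup>+ x) \<bullet> ?P \<zero> x \<bullet> (on_zero F \<^bold>+ \<i>\<d> (?F x)))
            \<^bold>+ (on_arr G (\<l>\<^sup>+ x) \<bullet> ?Q \<zero> x \<bullet> (on_zero G \<^bold>+ \<i>\<d> (?G x))))
          \<bullet> \<b> \<zero> \<zero> (?F x) (?G x)) \<bullet> (?i \<^bold>+ \<i>\<d> (?F x \<oplus> ?G x))"
      by (subst b_natural_cmp[where x = \<zero> and y = \<zero> and z = "?F x" and t = "?G x"])
        (simp_all add: add_interchange)
    also have "\<dots> = \<l>\<^sup>+ (?F x \<oplus> ?G x)"
      by (simp add: F.plus_l G.plus_l AC2_l' add_interchange flip: l_zero_eq_r_zero)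
    finally show "(on_arr F (\<l>\<^sup>+ x) \<^bold>+ on_arr G (\<l>\<^sup>+ x))
          \<bullet> ((?P \<zero> x \<^bold>+ ?Q \<zero> x) \<bullet> \<b> (?F \<zero>) (?G \<zero>) (?F x) (?G x))
          \<bullet> (((on_zero F \<^bold>+ on_zero G) \<bullet> ?i) \<^bold>+ \<i>\<d> (?F x \<oplus> ?G x)) = \<dots>" .
  next
    fix x
    assume [simp]: "x \<in> obj R"
    let ?i = "inverse_arr R (\<l>\<^sup>+ \<zero>)"
    have "(on_arr F (\<r>\<^sup>+ x) \<^bold>+ on_arr G (\<r>\<^sup>+ x))
          \<bullet> ((?P x \<zero> \<^bold>+ ?Q x \<zero>) \<bullet> \<b> (?F x) (?G x) (?F \<zero>) (?G \<zero>))
          \<bullet> (\<i>\<d> (?F x \<oplus> ?G x) \<^bold>+ ((on_zero F \<^bold>+ on_zero G) \<bullet> ?i))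
      = (on_arr F (\<r>\<^sup>+ x) \<^bold>+ on_arr G (\<r>\<^sup>+ x)) \<bullet> (?P x \<zero> \<^bold>+ ?Q x \<zero>)
          \<bullet> \<b> (?F x) (?G x) (?F \<zero>) (?G \<zero>)
          \<bullet> ((\<i>\<d> (?F x) \<^bold>+ \<i>\<d> (?G x)) \<^bold>+ (on_zero F \<^bold>+ on_zero G))
          \<bullet> (\<i>\<d> (?F x \<oplus> ?G x) \<^bold>+ ?i)"
      by (simp add: add_interchange)
    also have "\<dots> = (((on_arr F (\<r>\<^sup>+ x) \<bullet> ?P x \<zero> \<bullet> (\<i>\<d> (?F x) \<^bold>+ on_zero F))
            \<^bold>+ (on_arr G (\<r>\<^sup>+ x) \<bullet> ?Q x \<zero> \<bullet> (\<i>\<d> (?G x) \<^bold>+ on_zero G)))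
          \<bullet> \<b> (?F x) (?G x) \<zero> \<zero>) \<bullet> (\<i>\<d> (?F x \<oplus> ?G x) \<^bold>+ ?i)"
      by (subst b_natural_cmp[where z = \<zero> and t = \<zero> and x = "?F x" and y = "?G x"])
        (simp_all add: add_interchange)
    also have "\<dots> = \<r>\<^sup>+ (?F x \<oplus> ?G x)"
      by (simp add: F.plus_r G.plus_r AC2_r' add_interchange)
    finally show "(on_arr F (\<r>\<^sup>+ x) \<^bold>+ on_arr G (\<r>\<^sup>+ x))
          \<bullet> ((?P x \<zero> \<^bold>+ ?Q x \<zero>) \<bullet> \<b> (?F x) (?G x) (?F \<zero>) (?G \<zero>))
          \<bullet> (\<i>\<d> (?F x \<oplus> ?G x) \<^bold>+ ((on_zero F \<^bold>+ on_zero G) \<bullet> ?i)) = \<dots>" .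
  qed (auto simp: F.on_arr_cmp G.on_arr_cmp add_interchange)
qed

section \<open>AC natural isomorphisms\<close>

text \<open>
  The unit law of \<open>F\<close>, transported along \<open>\<tau>\<close>, says that \<open>\<tau> \<zero> \<bullet> on_zero F\<close>
  satisfies the unit law of \<open>G\<close>. That law has at most one solution: all arrows around it are
  invertible, and adding an object isomorphic to zero is faithful.
\<close>

lemma zero_compat_of_plus_compat:
  assumes "ac_endofunctor R F" "ac_endofunctor R G"
    and component: "\<And>x. x \<in> obj R \<Longrightarrow> \<tau> x \<in> hom R (on_obj F x) (on_obj G x)"
    and natural: "\<And>f x y. f \<in> hom R x y \<Longrightarrow> \<tau> y \<bullet> on_arr F f = on_arr G f \<bullet> \<tau> x"
    and plus: "\<And>x y. x \<in> obj R \<Longrightarrow> y \<in> obj R \<Longrightarrow>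
      \<tau> (x \<oplus> y) \<bullet> on_plus F x y = on_plus G x y \<bullet> (\<tau> x \<^bold>+ \<tau> y)"
  shows "\<tau> \<zero> \<bullet> on_zero F = on_zero G"
proof -
  interpret F: ac_endofunctor R F by fact
  interpret G: ac_endofunctor R G by fact
  have [simp]: "\<tau> x \<in> arr R" "src R (\<tau> x) = on_obj F x" "trg R (\<tau> x) = on_obj G x"
    if "x \<in> obj R" for x
    using component[OF that] by simp_all
  let ?F = "on_obj F \<zero>" and ?G = "on_obj G \<zero>" and ?z = "\<tau> \<zero> \<bullet> on_zero F"
  let ?u = "on_arr G (\<r>\<^sup>+ \<zero>) \<bullet> on_plus G \<zero> \<zero>"
  have "?u \<bullet> (\<tau> \<zero> \<^bold>+ ?z) = on_arr G (\<r>\<^sup>+ \<zero>) \<bullet> (on_plus G \<zero> \<zero> \<bullet> (\<tau> \<zero> \<^bold>+ \<tau> \<zero>)) \<bullet> (\<i>\<d> ?F \<^bold>+ on_zero F)"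
    by (simp add: add_interchange)
  also have "\<dots> = (on_arr G (\<r>\<^sup>+ \<zero>) \<bullet> \<tau> (\<zero> \<oplus> \<zero>)) \<bullet> on_plus F \<zero> \<zero> \<bullet> (\<i>\<d> ?F \<^bold>+ on_zero F)"
    by (simp flip: plus)
  also have "\<dots> = \<tau> \<zero> \<bullet> on_arr F (\<r>\<^sup>+ \<zero>) \<bullet> on_plus F \<zero> \<zero> \<bullet> (\<i>\<d> ?F \<^bold>+ on_zero F)"
    using natural[of "\<r>\<^sup>+ \<zero>" "\<zero> \<oplus> \<zero>" \<zero>, symmetric] by simp
  also have "\<dots> = \<r>\<^sup>+ ?G \<bullet> (\<tau> \<zero> \<^bold>+ \<i>\<d> \<zero>)"
    using add_r_natural[of "\<tau> \<zero>" ?F ?G] by (simp add: F.plus_r)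
  also have "\<dots> = ?u \<bullet> (\<tau> \<zero> \<^bold>+ on_zero G)"
    using G.plus_r[of \<zero>, symmetric] by (simp add: add_interchange)
  finally have "\<tau> \<zero> \<^bold>+ ?z = \<tau> \<zero> \<^bold>+ on_zero G"
    by (rule cancel_left) simp_all
  \<comment> \<open>precomposing turns the left summand into \<open>?z\<close>, which splits off as an invertible factor
    and leaves \<open>\<i>\<d> \<zero>\<close>\<close>
  then have "(\<tau> \<zero> \<^bold>+ ?z) \<bullet> (on_zero F \<^bold>+ \<i>\<d> \<zero>) = (\<tau> \<zero> \<^bold>+ on_zero G) \<bullet> (on_zero F \<^bold>+ \<i>\<d> \<zero>)"
    by simp
  then have "(?z \<^bold>+ \<i>\<d> ?G) \<bullet> (\<i>\<d> \<zero> \<^bold>+ ?z) = (?z \<^bold>+ \<i>\<d> ?G) \<bullet> (\<i>\<d> \<zero> \<^bold>+ on_zero G)"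
    by (simp add: add_interchange)
  then have "\<i>\<d> \<zero> \<^bold>+ ?z = \<i>\<d> \<zero> \<^bold>+ on_zero G"
    by (rule cancel_left) simp_all
  then show ?thesis
    by (rule add_zero_left_inject) simp_all
qed

lemma ac_natural_iso_iff:
  assumes F: "ac_endofunctor R F" and G: "ac_endofunctor R G"
    and component: "\<And>x. x \<in> obj R \<Longrightarrow> \<tau> x \<in> hom R (on_obj F x) (on_obj G x)"
    and natural: "\<And>f x y. f \<in> hom R x y \<Longrightarrow> \<tau> y \<bullet> on_arr F f = on_arr G f \<bullet> \<tau> x"
  shows "ac_natural_iso R F G \<tau> \<longleftrightarrow> (\<forall>x \<in> obj R. \<forall>y \<in> obj R.
      \<tau> (x \<oplus> y) \<bullet> on_plus F x y = on_plus G x y \<bullet> (\<tau> x \<^bold>+ \<tau> y))"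
  using assms zero_compat_of_plus_compat[OF assms]
  by (auto simp: ac_natural_iso_def ac_natural_iso_axioms_def)

end

section \<open>Multiplications as AC endofunctors\<close>

text \<open>
  The data that both sides of the characterisation start from: distributors natural in all
  variables, and absorbing isomorphisms \<open>\<m>\<close>, \<open>\<n>\<close> as bare families.
\<close>

locale distributive_data = ac_2group R + monoidal R
  for R :: "('o, 'm, 'r) ring_data_scheme" (structure) +
  assumes d_iso: "\<lbrakk>x \<in> obj R; y \<in> obj R; z \<in> obj R\<rbrakk> \<Longrightarrow>
      \<d> x y z \<in> iso R (x \<otimes> y \<oplus> x \<otimes> z) (x \<otimes> (y \<oplus> z))"
    and d_natural: "\<lbrakk>f \<in> hom R x x'; g \<in> hom R y y'; h \<in> hom R z z'\<rbrakk> \<Longrightarrow>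
      \<d> x' y' z' \<bullet> (f \<^bold>* g \<^bold>+ f \<^bold>* h) = (f \<^bold>* (g \<^bold>+ h)) \<bullet> \<d> x y z"
    and e_iso: "\<lbrakk>x \<in> obj R; y \<in> obj R; z \<in> obj R\<rbrakk> \<Longrightarrow>
      \<e> x y z \<in> iso R (x \<otimes> z \<oplus> y \<otimes> z) ((x \<oplus> y) \<otimes> z)"
    and e_natural: "\<lbrakk>f \<in> hom R x x'; g \<in> hom R y y'; h \<in> hom R z z'\<rbrakk> \<Longrightarrow>
      \<e> x' y' z' \<bullet> (f \<^bold>* h \<^bold>+ g \<^bold>* h) = ((f \<^bold>+ g) \<^bold>* h) \<bullet> \<e> x y z"
    and m_iso: "x \<in> obj R \<Longrightarrow> \<m> x \<in> iso R \<zero> (x \<otimes> \<zero>)"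
    and n_iso: "x \<in> obj R \<Longrightarrow> \<n> x \<in> iso R \<zero> (\<zero> \<otimes> x)"
begin

lemmas mult_simps [simp] = bifunctor_simps[OF mult_bifunctor]
lemmas mult_interchange = bifunctor_interchange[OF mult_bifunctor]

lemma one_obj [simp]: "\<one> \<in> obj R"
  by (rule one_in_obj)

lemma mult_a_simps [simp]:
  assumes "x \<in> obj R" "y \<in> obj R" "z \<in> obj R"
  shows "\<a>\<^sup>\<times> x y z \<in> arr R" "src R (\<a>\<^sup>\<times> x y z) = x \<otimes> (y \<otimes> z)" "trg R (\<a>\<^sup>\<times> x y z) = (x \<otimes> y) \<otimes> z"
  using mult_a_iso[OF assms] by simp_all

lemma mult_unitor_simps [simp]:
  assumes "x \<in> obj R"
  shows "\<l>\<^sup>\<times> x \<in> arr R" "src R (\<l>\<^sup>\<times> x) = \<one> \<otimes> x" "trg R (\<l>\<^sup>\<times> x) = x"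
    and "\<r>\<^sup>\<times> x \<in> arr R" "src R (\<r>\<^sup>\<times> x) = x \<otimes> \<one>" "trg R (\<r>\<^sup>\<times> x) = x"
  using mult_l_iso[OF assms] mult_r_iso[OF assms] by simp_all

lemma distributor_simps [simp]:
  assumes "x \<in> obj R" "y \<in> obj R" "z \<in> obj R"
  shows "\<d> x y z \<in> arr R" "src R (\<d> x y z) = x \<otimes> y \<oplus> x \<otimes> z" "trg R (\<d> x y z) = x \<otimes> (y \<oplus> z)"
    and "\<e> x y z \<in> arr R" "src R (\<e> x y z) = x \<otimes> z \<oplus> y \<otimes> z" "trg R (\<e> x y z) = (x \<oplus> y) \<otimes> z"
  using d_iso[OF assms] e_iso[OF assms] by simp_all

lemma absorber_simps [simp]:
  assumes "x \<in> obj R"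
  shows "\<m> x \<in> arr R" "src R (\<m> x) = \<zero>" "trg R (\<m> x) = x \<otimes> \<zero>"
    and "\<n> x \<in> arr R" "src R (\<n> x) = \<zero>" "trg R (\<n> x) = \<zero> \<otimes> x"
  using m_iso[OF assms] n_iso[OF assms] by simp_all

lemma left_mult_simps [simp]:
  "on_obj (left_mult R x) y = x \<otimes> y"
  "on_arr (left_mult R x) f = \<i>\<d> x \<^bold>* f"
  "on_plus (left_mult R x) y z = \<d> x y z"
  "on_zero (left_mult R x) = \<m> x"
  by (simp_all add: left_mult_def)

lemma right_mult_simps [simp]:
  "on_obj (right_mult R x) y = y \<otimes> x"
  "on_arr (right_mult R x) f = f \<^bold>* \<i>\<d> x"
  "on_plus (right_mult R x) y z = \<e> y z x"
  "on_zero (right_mult R x) = \<n> x"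
  by (simp_all add: right_mult_def)

lemma left_mult_ac_iff:
  assumes x: "x \<in> obj R"
  shows "ac_endofunctor R (left_mult R x) \<longleftrightarrow>
    (\<forall>y \<in> obj R. \<forall>z \<in> obj R. \<forall>t \<in> obj R. \<forall>u \<in> obj R.
      \<d> x (y \<oplus> t) (z \<oplus> u) \<bullet> (\<d> x y t \<^bold>+ \<d> x z u) \<bullet> \<b> (x \<otimes> y) (x \<otimes> z) (x \<otimes> t) (x \<otimes> u)
        = (\<i>\<d> x \<^bold>* \<b> y z t u) \<bullet> \<d> x (y \<oplus> z) (t \<oplus> u) \<bullet> (\<d> x y z \<^bold>+ \<d> x t u)) \<and>
    (\<forall>y \<in> obj R.
      (\<i>\<d> x \<^bold>* \<l>\<^sup>+ y) \<bullet> \<d> x \<zero> y \<bullet> (\<m> x \<^bold>+ \<i>\<d> (x \<otimes> y)) = \<l>\<^sup>+ (x \<otimes> y) \<and>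
      (\<i>\<d> x \<^bold>* \<r>\<^sup>+ y) \<bullet> \<d> x y \<zero> \<bullet> (\<i>\<d> (x \<otimes> y) \<^bold>+ \<m> x) = \<r>\<^sup>+ (x \<otimes> y))"
    (is "?ac \<longleftrightarrow> ?eqs")
proof
  assume ?ac
  then interpret F: ac_endofunctor R "left_mult R x" .
  show ?eqs
    using F.plus_b F.plus_l F.plus_r by simp
next
  assume ?eqs
  moreover have "\<d> x y' z' \<bullet> (\<i>\<d> x \<^bold>* g \<^bold>+ \<i>\<d> x \<^bold>* h) = (\<i>\<d> x \<^bold>* (g \<^bold>+ h)) \<bullet> \<d> x y z"
    if "g \<in> hom R y y'" "h \<in> hom R z z'" for g h y y' z z'
    using x that by (intro d_natural) simp_all
  ultimately show ?ac
    using x by unfold_locales (auto simp: mult_interchange)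
qed

lemma right_mult_ac_iff:
  assumes u: "u \<in> obj R"
  shows "ac_endofunctor R (right_mult R u) \<longleftrightarrow>
    (\<forall>x \<in> obj R. \<forall>y \<in> obj R. \<forall>z \<in> obj R. \<forall>t \<in> obj R.
      \<e> (x \<oplus> z) (y \<oplus> t) u \<bullet> (\<e> x z u \<^bold>+ \<e> y t u) \<bullet> \<b> (x \<otimes> u) (y \<otimes> u) (z \<otimes> u) (t \<otimes> u)
        = (\<b> x y z t \<^bold>* \<i>\<d> u) \<bullet> \<e> (x \<oplus> y) (z \<oplus> t) u \<bullet> (\<e> x y u \<^bold>+ \<e> z t u)) \<and>
    (\<forall>x \<in> obj R.
      (\<l>\<^sup>+ x \<^bold>* \<i>\<d> u) \<bullet> \<e> \<zero> x u \<bullet> (\<n> u \<^bold>+ \<i>\<d> (x \<otimes> u)) = \<l>\<^sup>+ (x \<otimes> u) \<and>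
      (\<r>\<^sup>+ x \<^bold>* \<i>\<d> u) \<bullet> \<e> x \<zero> u \<bullet> (\<i>\<d> (x \<otimes> u) \<^bold>+ \<n> u) = \<r>\<^sup>+ (x \<otimes> u))"
    (is "?ac \<longleftrightarrow> ?eqs")
proof
  assume ?ac
  then interpret F: ac_endofunctor R "right_mult R u" .
  show ?eqs
    using F.plus_b F.plus_l F.plus_r by simp
next
  assume ?eqs
  moreover have "\<e> x' y' u \<bullet> (f \<^bold>* \<i>\<d> u \<^bold>+ g \<^bold>* \<i>\<d> u) = ((f \<^bold>+ g) \<^bold>* \<i>\<d> u) \<bullet> \<e> x y u"
    if "f \<in> hom R x x'" "g \<in> hom R y y'" for f g x x' y y'
    using u that by (intro e_natural) simp_all
  ultimately show ?ac
    using u by unfold_locales (auto simp: mult_interchange)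
qed

text \<open>
  Apply \<open>zero_compat_of_plus_compat\<close> to the transformation \<open>f \<^bold>* -\<close> between left
  multiplications: its compatibility with zero is the naturality square of \<open>\<m>\<close> at \<open>f\<close>.
\<close>

lemma m_natural:
  assumes ac: "\<And>x. x \<in> obj R \<Longrightarrow> ac_endofunctor R (left_mult R x)"
    and f: "f \<in> hom R x x'"
  shows "\<m> x' = (f \<^bold>* \<i>\<d> \<zero>) \<bullet> \<m> x"
proof -
  have [simp]: "f \<in> arr R" "x \<in> obj R" "x' \<in> obj R" "src R f = x" "trg R f = x'"
    using f by auto
  have "(f \<^bold>* \<i>\<d> \<zero>) \<bullet> on_zero (left_mult R x) = on_zero (left_mult R x')"
  proof (rule zero_compat_of_plus_compat)
    show "(f \<^bold>* \<i>\<d> (y \<oplus> z)) \<bullet> on_plus (left_mult R x) y z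
        = on_plus (left_mult R x') y z \<bullet> (f \<^bold>* \<i>\<d> y \<^bold>+ f \<^bold>* \<i>\<d> z)"
      if "y \<in> obj R" "z \<in> obj R" for y z
      using d_natural[OF f id_hom id_hom] that by simp
  qed (auto simp: ac mult_interchange)
  then show ?thesis
    by simp
qed

lemma n_natural:
  assumes ac: "\<And>x. x \<in> obj R \<Longrightarrow> ac_endofunctor R (right_mult R x)"
    and f: "f \<in> hom R x x'"
  shows "\<n> x' = (\<i>\<d> \<zero> \<^bold>* f) \<bullet> \<n> x"
proof -
  have [simp]: "f \<in> arr R" "x \<in> obj R" "x' \<in> obj R" "src R f = x" "trg R f = x'"
    using f by auto
  have "(\<i>\<d> \<zero> \<^bold>* f) \<bullet> on_zero (right_mult R x) = on_zero (right_mult R x')"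
  proof (rule zero_compat_of_plus_compat)
    show "(\<i>\<d> (y \<oplus> z) \<^bold>* f) \<bullet> on_plus (right_mult R x) y z
        = on_plus (right_mult R x') y z \<bullet> (\<i>\<d> y \<^bold>* f \<^bold>+ \<i>\<d> z \<^bold>* f)"
      if "y \<in> obj R" "z \<in> obj R" for y z
      using e_natural[OF id_hom id_hom f] that by simp
  qed (auto simp: ac mult_interchange)
  then show ?thesis
    by simp
qed

end

section \<open>Compatibility of the two multiplications\<close>

text \<open>
  In both directions of the characterisation the multiplications are first seen to be AC
  endofunctors, since the notion of AC natural isomorphism presupposes it.
\<close>

locale distributive_ac_data = distributive_data +
  assumes left_ac: "x \<in> obj R \<Longrightarrow> ac_endofunctor R (left_mult R x)"
    and right_ac: "x \<in> obj R \<Longrightarrow> ac_endofunctor R (right_mult R x)"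
begin

text \<open>
  The condition on AC natural isomorphisms has \<open>\<b>\<close> on the side of the sum of endofunctors,
  the equation on the side of \<open>\<d> (x \<oplus> y)\<close>; \<open>b_involutive\<close> passes from one to the other.
\<close>

lemma R2_iff:
  assumes [simp]: "x \<in> obj R" "y \<in> obj R"
  shows "ac_natural_iso R (left_mult R x \<boxplus> left_mult R y) (left_mult R (x \<oplus> y)) (\<lambda>z. \<e> x y z) \<longleftrightarrow>
    (\<forall>z \<in> obj R. \<forall>t \<in> obj R.
      \<d> (x \<oplus> y) z t \<bullet> (\<e> x y z \<^bold>+ \<e> x y t) \<bullet> \<b> (x \<otimes> z) (x \<otimes> t) (y \<otimes> z) (y \<otimes> t)
        = \<e> x y (z \<oplus> t) \<bullet> (\<d> x z t \<^bold>+ \<d> y z t))" (is "?ac \<longleftrightarrow> _")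
proof -
  have "?ac \<longleftrightarrow> (\<forall>z \<in> obj R. \<forall>t \<in> obj R.
      \<e> x y (z \<oplus> t) \<bullet> (\<d> x z t \<^bold>+ \<d> y z t) \<bullet> \<b> (x \<otimes> z) (y \<otimes> z) (x \<otimes> t) (y \<otimes> t)
        = \<d> (x \<oplus> y) z t \<bullet> (\<e> x y z \<^bold>+ \<e> x y t))"
    using left_ac endo_sum_ac e_natural[OF id_hom id_hom]
    by (subst ac_natural_iso_iff) auto
  also have "\<dots> \<longleftrightarrow> (\<forall>z \<in> obj R. \<forall>t \<in> obj R.
      \<d> (x \<oplus> y) z t \<bullet> (\<e> x y z \<^bold>+ \<e> x y t) \<bullet> \<b> (x \<otimes> z) (x \<otimes> t) (y \<otimes> z) (y \<otimes> t)
        = \<e> x y (z \<oplus> t) \<bullet> (\<d> x z t \<^bold>+ \<d> y z t))"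
  proof (intro ball_cong refl)
    fix z t
    assume [simp]: "z \<in> obj R" "t \<in> obj R"
    let ?b = "\<b> (x \<otimes> z) (y \<otimes> z) (x \<otimes> t) (y \<otimes> t)" and ?b' = "\<b> (x \<otimes> z) (x \<otimes> t) (y \<otimes> z) (y \<otimes> t)"
    let ?g = "\<e> x y (z \<oplus> t) \<bullet> (\<d> x z t \<^bold>+ \<d> y z t)" and ?h = "\<d> (x \<oplus> y) z t \<bullet> (\<e> x y z \<^bold>+ \<e> x y t)"
    have "(?g \<bullet> ?b = ?h) \<longleftrightarrow> (?h \<bullet> ?b' = ?g)"
    proof
      assume "?g \<bullet> ?b = ?h"
      then have "?h \<bullet> ?b' = (?g \<bullet> ?b) \<bullet> ?b'"
        by (rule arg_cong2[OF sym refl])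
      then show "?h \<bullet> ?b' = ?g"
        by (simp add: b_involutive)
    next
      assume "?h \<bullet> ?b' = ?g"
      then have "?g \<bullet> ?b = (?h \<bullet> ?b') \<bullet> ?b"
        by (rule arg_cong2[OF sym refl])
      then show "?g \<bullet> ?b = ?h"
        by (simp add: b_involutive)
    qed
    then show "(\<e> x y (z \<oplus> t) \<bullet> (\<d> x z t \<^bold>+ \<d> y z t) \<bullet> ?b = ?h) \<longleftrightarrow>
      (\<d> (x \<oplus> y) z t \<bullet> (\<e> x y z \<^bold>+ \<e> x y t) \<bullet> ?b' = ?g)"
      by simp
  qed
  finally show ?thesis .
qed

lemma R3_iff:
  assumes [simp]: "x \<in> obj R" "y \<in> obj R"
  shows "ac_natural_iso R (left_mult R x \<odot> left_mult R y) (left_mult R (x \<otimes> y)) (\<lambda>z. \<a>\<^sup>\<times> x y z) \<longleftrightarrow>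
    (\<forall>z \<in> obj R. \<forall>t \<in> obj R.
      \<d> (x \<otimes> y) z t \<bullet> (\<a>\<^sup>\<times> x y z \<^bold>+ \<a>\<^sup>\<times> x y t)
        = \<a>\<^sup>\<times> x y (z \<oplus> t) \<bullet> (\<i>\<d> x \<^bold>* \<d> y z t) \<bullet> \<d> x (y \<otimes> z) (y \<otimes> t))"
  using left_ac endo_comp_ac mult_a_natural[OF id_hom id_hom]
  by (subst ac_natural_iso_iff) auto

lemma R4_iff:
  assumes [simp]: "x \<in> obj R" "y \<in> obj R"
  shows "ac_natural_iso R (left_mult R x \<odot> right_mult R y) (right_mult R y \<odot> left_mult R x)
      (\<lambda>z. \<a>\<^sup>\<times> x z y) \<longleftrightarrow>
    (\<forall>z \<in> obj R. \<forall>t \<in> obj R.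
      (\<d> x z t \<^bold>* \<i>\<d> y) \<bullet> \<e> (x \<otimes> z) (x \<otimes> t) y \<bullet> (\<a>\<^sup>\<times> x z y \<^bold>+ \<a>\<^sup>\<times> x t y)
        = \<a>\<^sup>\<times> x (z \<oplus> t) y \<bullet> (\<i>\<d> x \<^bold>* \<e> z t y) \<bullet> \<d> x (z \<otimes> y) (t \<otimes> y))"
  using left_ac right_ac endo_comp_ac mult_a_natural[OF id_hom _ id_hom]
  by (subst ac_natural_iso_iff) auto

lemma R5_iff:
  assumes [simp]: "x \<in> obj R" "y \<in> obj R"
  shows "ac_natural_iso R (right_mult R (y \<otimes> x)) (right_mult R x \<odot> right_mult R y) (\<lambda>z. \<a>\<^sup>\<times> z y x) \<longleftrightarrow>
    (\<forall>t \<in> obj R. \<forall>z \<in> obj R.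
      (\<e> t z y \<^bold>* \<i>\<d> x) \<bullet> \<e> (t \<otimes> y) (z \<otimes> y) x \<bullet> (\<a>\<^sup>\<times> t y x \<^bold>+ \<a>\<^sup>\<times> z y x)
        = \<a>\<^sup>\<times> (t \<oplus> z) y x \<bullet> \<e> t z (y \<otimes> x))"
  using right_ac endo_comp_ac mult_a_natural[OF _ id_hom id_hom]
  by (subst ac_natural_iso_iff) auto

lemma R6_l_iff:
  "ac_natural_iso R (left_mult R \<one>) (endo_id R) (\<lambda>x. \<l>\<^sup>\<times> x) \<longleftrightarrow>
    (\<forall>x \<in> obj R. \<forall>y \<in> obj R. \<l>\<^sup>\<times> (x \<oplus> y) \<bullet> \<d> \<one> x y = \<l>\<^sup>\<times> x \<^bold>+ \<l>\<^sup>\<times> y)"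
  using left_ac endo_id_ac mult_l_natural
  by (subst ac_natural_iso_iff) auto

lemma R6_r_iff:
  "ac_natural_iso R (right_mult R \<one>) (endo_id R) (\<lambda>x. \<r>\<^sup>\<times> x) \<longleftrightarrow>
    (\<forall>x \<in> obj R. \<forall>y \<in> obj R. \<r>\<^sup>\<times> (x \<oplus> y) \<bullet> \<e> x y \<one> = \<r>\<^sup>\<times> x \<^bold>+ \<r>\<^sup>\<times> y)"
  using right_ac endo_id_ac mult_r_natural
  by (subst ac_natural_iso_iff) auto

end

section \<open>The characterisation of AC 2-rings\<close>

theorem proposition3p9:
  fixes R :: "('o, 'm) ring_data" (structure)
  assumes "groupoid R" and "ac_2group R" and "monoidal R"
    and "\<And>x y z. \<lbrakk>x \<in> obj R; y \<in> obj R; z \<in> obj R\<rbrakk> \<Longrightarrow>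
      \<d> x y z \<in> iso R (x \<otimes> y \<oplus> x \<otimes> z) (x \<otimes> (y \<oplus> z))"
    and "\<And>f g h x x' y y' z z'. \<lbrakk>f \<in> hom R x x'; g \<in> hom R y y'; h \<in> hom R z z'\<rbrakk> \<Longrightarrow>
      \<d> x' y' z' \<bullet> (f \<^bold>* g \<^bold>+ f \<^bold>* h) = (f \<^bold>* (g \<^bold>+ h)) \<bullet> \<d> x y z"
    and "\<And>x y z. \<lbrakk>x \<in> obj R; y \<in> obj R; z \<in> obj R\<rbrakk> \<Longrightarrow>
      \<e> x y z \<in> iso R (x \<otimes> z \<oplus> y \<otimes> z) ((x \<oplus> y) \<otimes> z)"
    and "\<And>f g h x x' y y' z z'. \<lbrakk>f \<in> hom R x x'; g \<in> hom R y y'; h \<in> hom R z z'\<rbrakk> \<Longrightarrow>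
      \<e> x' y' z' \<bullet> (f \<^bold>* h \<^bold>+ g \<^bold>* h) = ((f \<^bold>+ g) \<^bold>* h) \<bullet> \<e> x y z"
    and "\<And>x. x \<in> obj R \<Longrightarrow> \<m> x \<in> iso R \<zero> (x \<otimes> \<zero>)"
    and "\<And>x. x \<in> obj R \<Longrightarrow> \<n> x \<in> iso R \<zero> (\<zero> \<otimes> x)"
  shows "ac_2ring R \<longleftrightarrow>
    (\<forall>x x' f. f \<in> hom R x x' \<longrightarrow> \<m> x' = (f \<^bold>* \<i>\<d> \<zero>) \<bullet> \<m> x) \<and>
    (\<forall>x x' f. f \<in> hom R x x' \<longrightarrow> \<n> x' = (\<i>\<d> \<zero> \<^bold>* f) \<bullet> \<n> x) \<and>
    (\<forall>x \<in> obj R. \<forall>y \<in> obj R. \<forall>z \<in> obj R. \<forall>t \<in> obj R. \<forall>u \<in> obj R.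
      \<comment> \<open>(2R1)''\<close>
      \<d> x (y \<oplus> t) (z \<oplus> u) \<bullet> (\<d> x y t \<^bold>+ \<d> x z u) \<bullet> \<b> (x \<otimes> y) (x \<otimes> z) (x \<otimes> t) (x \<otimes> u)
        = (\<i>\<d> x \<^bold>* \<b> y z t u) \<bullet> \<d> x (y \<oplus> z) (t \<oplus> u) \<bullet> (\<d> x y z \<^bold>+ \<d> x t u) \<and>
      \<e> (x \<oplus> z) (y \<oplus> t) u \<bullet> (\<e> x z u \<^bold>+ \<e> y t u) \<bullet> \<b> (x \<otimes> u) (y \<otimes> u) (z \<otimes> u) (t \<otimes> u)
        = (\<b> x y z t \<^bold>* \<i>\<d> u) \<bullet> \<e> (x \<oplus> y) (z \<oplus> t) u \<bullet> (\<e> x y u \<^bold>+ \<e> z t u) \<and>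
      (\<i>\<d> x \<^bold>* \<l>\<^sup>+ y) \<bullet> \<d> x \<zero> y \<bullet> (\<m> x \<^bold>+ \<i>\<d> (x \<otimes> y)) = \<l>\<^sup>+ (x \<otimes> y) \<and>
      (\<i>\<d> x \<^bold>* \<r>\<^sup>+ y) \<bullet> \<d> x y \<zero> \<bullet> (\<i>\<d> (x \<otimes> y) \<^bold>+ \<m> x) = \<r>\<^sup>+ (x \<otimes> y) \<and>
      (\<l>\<^sup>+ x \<^bold>* \<i>\<d> y) \<bullet> \<e> \<zero> x y \<bullet> (\<n> y \<^bold>+ \<i>\<d> (x \<otimes> y)) = \<l>\<^sup>+ (x \<otimes> y) \<and>
      (\<r>\<^sup>+ x \<^bold>* \<i>\<d> y) \<bullet> \<e> x \<zero> y \<bullet> (\<i>\<d> (x \<otimes> y) \<^bold>+ \<n> y) = \<r>\<^sup>+ (x \<otimes> y) \<and>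
      \<comment> \<open>(2R2)\<close>
      \<d> (x \<oplus> y) z t \<bullet> (\<e> x y z \<^bold>+ \<e> x y t) \<bullet> \<b> (x \<otimes> z) (x \<otimes> t) (y \<otimes> z) (y \<otimes> t)
        = \<e> x y (z \<oplus> t) \<bullet> (\<d> x z t \<^bold>+ \<d> y z t) \<and>
      \<comment> \<open>(2R3)\<close>
      \<d> (x \<otimes> y) z t \<bullet> (\<a>\<^sup>\<times> x y z \<^bold>+ \<a>\<^sup>\<times> x y t)
        = \<a>\<^sup>\<times> x y (z \<oplus> t) \<bullet> (\<i>\<d> x \<^bold>* \<d> y z t) \<bullet> \<d> x (y \<otimes> z) (y \<otimes> t) \<and>
      \<comment> \<open>(2R4)\<close>
      (\<d> x z t \<^bold>* \<i>\<d> y) \<bullet> \<e> (x \<otimes> z) (x \<otimes> t) y \<bullet> (\<a>\<^sup>\<times> x z y \<^bold>+ \<a>\<^sup>\<times> x t y)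
        = \<a>\<^sup>\<times> x (z \<oplus> t) y \<bullet> (\<i>\<d> x \<^bold>* \<e> z t y) \<bullet> \<d> x (z \<otimes> y) (t \<otimes> y) \<and>
      \<comment> \<open>(2R5)\<close>
      (\<e> t z y \<^bold>* \<i>\<d> x) \<bullet> \<e> (t \<otimes> y) (z \<otimes> y) x \<bullet> (\<a>\<^sup>\<times> t y x \<^bold>+ \<a>\<^sup>\<times> z y x)
        = \<a>\<^sup>\<times> (t \<oplus> z) y x \<bullet> \<e> t z (y \<otimes> x) \<and>
      \<comment> \<open>(2R6)\<close>
      \<l>\<^sup>\<times> (x \<oplus> y) \<bullet> \<d> \<one> x y = \<l>\<^sup>\<times> x \<^bold>+ \<l>\<^sup>\<times> y \<and>
      \<r>\<^sup>\<times> (x \<oplus> y) \<bullet> \<e> x y \<one> = \<r>\<^sup>\<times> x \<^bold>+ \<r>\<^sup>\<times> y)"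
  (is "_ \<longleftrightarrow> ?m_natural \<and> ?n_natural \<and> ?equations")
proof -
  interpret distributive_data R
    using assms by (intro distributive_data.intro distributive_data_axioms.intro)
  show ?thesis
  proof
    assume "ac_2ring R"
    then interpret ring: ac_2ring R .
    interpret distributive_ac_data R
      using ring.left_mult_ac ring.right_mult_ac
      by (intro distributive_ac_data.intro distributive_ac_data_axioms.intro distributive_data_axioms)
    have ?m_natural ?n_natural
      using m_natural n_natural left_ac right_ac by blast+
    moreover have ?equations
    proof -
      note left = iffD1[OF left_mult_ac_iff ring.left_mult_ac]
        and right = iffD1[OF right_mult_ac_iff ring.right_mult_ac]
      note eqs = left[THEN conjunct1, rule_format] right[THEN conjunct1, rule_format]
        left[THEN conjunct2, rule_format, THEN conjunct1] left[THEN conjunct2, rule_format, THEN conjunct2]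
        right[THEN conjunct2, rule_format, THEN conjunct1] right[THEN conjunct2, rule_format, THEN conjunct2]
        iffD1[OF R2_iff ring.R2, rule_format] iffD1[OF R3_iff ring.R3, rule_format]
        iffD1[OF R4_iff ring.R4, rule_format] iffD1[OF R5_iff ring.R5, rule_format]
        iffD1[OF R6_l_iff ring.R6_l, rule_format] iffD1[OF R6_r_iff ring.R6_r, rule_format]
      show ?thesis
        by (intro ballI conjI; rule eqs; assumption)
    qed
    ultimately show "?m_natural \<and> ?n_natural \<and> ?equations"
      by blast
  next
    assume "?m_natural \<and> ?n_natural \<and> ?equations"
    then have eqs: ?equations
      by blast
    interpret distributive_ac_data R
    proof (intro distributive_ac_data.intro distributive_ac_data_axioms.intro distributive_data_axioms)
      show "ac_endofunctor R (left_mult R x)" if "x \<in> obj R" for x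
        using eqs that by (subst left_mult_ac_iff) simp_all
      show "ac_endofunctor R (right_mult R x)" if "x \<in> obj R" for x
        using eqs that by (subst right_mult_ac_iff) simp_all
    qed
    show "ac_2ring R"
    proof (intro ac_2ring.intro ac_2ring_axioms.intro assms left_ac right_ac)
      fix x y
      assume x: "x \<in> obj R" and y: "y \<in> obj R"
      show "ac_natural_iso R (left_mult R x \<boxplus> left_mult R y) (left_mult R (x \<oplus> y)) (\<lambda>z. \<e> x y z)"
        using eqs x y by (subst R2_iff) simp_all
      show "ac_natural_iso R (left_mult R x \<odot> left_mult R y) (left_mult R (x \<otimes> y)) (\<lambda>z. \<a>\<^sup>\<times> x y z)"
        using eqs x y by (subst R3_iff) simp_all
      show "ac_natural_iso R (left_mult R x \<odot> right_mult R y) (right_mult R y \<odot> left_mult R x)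
          (\<lambda>z. \<a>\<^sup>\<times> x z y)"
        using eqs x y by (subst R4_iff) simp_all
      show "ac_natural_iso R (right_mult R (x \<otimes> y)) (right_mult R y \<odot> right_mult R x)
          (\<lambda>z. \<a>\<^sup>\<times> z x y)"
        using eqs x y by (subst R5_iff) simp_all
    next
      show "ac_natural_iso R (left_mult R \<one>) (endo_id R) (\<lambda>x. \<l>\<^sup>\<times> x)"
        using eqs by (subst R6_l_iff) simp
      show "ac_natural_iso R (right_mult R \<one>) (endo_id R) (\<lambda>x. \<r>\<^sup>\<times> x)"
        using eqs by (subst R6_r_iff) simp
    qed
  qed
qed

end
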